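(* Fix an integer $n\geq 3$. Let $\Omega\subseteq\mathbb{R}$ be modulus-closed, of pd-type, and such that $I:=\Omega\cap[0,\infty)$ is an interval. Then the following are equivalent for a function $f:\Omega\to\mathbb{C}$: (1) A symmetric matrix $A\in M_n(\Omega)$ is positive definite if and only if $f[A]$ is positive definite. (2) There exists a real $\alpha>0$ such that $f(x)=\alpha x$ for all $x\in\Omega$. The result holds verbatim with "pd-type" replaced by "psd-type" and "definite" replaced by "semidefinite".
   Context: $M_n(\Omega)$ denotes the set of $n\times n$ matrices with entries in $\Omega$, and $f[A]:=(f(a_{ij}))$ for $A=(a_{ij})$. Positive (semi)definite matrices are Hermitian by definition. A set $\Omega$ is modulus-closed if $z\in\Omega$ implies $|z|\in\Omega$. With $I:=\Omega\cap[0,\infty)$, $\Omega$ is of pd-type if for all $z\in\Omega\setminus I$ there exists $\epsilon>0$ such that $|z|+\epsilon\in I$; and of psd-type if for all $z\in\Omega\setminus I$ there exists $\delta>0$ such that $|z|-\delta\in I$.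
   Formalization: The interval I is additionally assumed not to be a single point; for I = {c} the stated equivalence fails (e.g. Ω = {c}, c > 0: f(c) = -1 in the definite case, f(c) = 0 in the semidefinite case, satisfy (1) but not (2)). *)

theory Defs
  imports
    "HOL-Analysis.Topology_Euclidean_Space"
    "Jordan_Normal_Form.Schur_Decomposition"
begin

definition hermitian :: "complex mat \<Rightarrow> bool" where
  "hermitian A \<longleftrightarrow> mat_adjoint A = A"

text \<open>
  The quadratic form \<open>v* A v\<close> is a complex number; it is compared with 0 in the order of
  \<open>HOL-Library.Complex_Order\<close>, where \<open>0 \<le> z\<close> means that \<open>z\<close> is real and nonnegative.
\<close>

definition positive_definite :: "complex mat \<Rightarrow> bool" where
  "positive_definite A \<longleftrightarrow> hermitian A \<and>
     (\<forall>v \<in> carrier_vec (dim_row A). v \<noteq> 0\<^sub>v (dim_row A) \<longrightarrow> 0 < (A *\<^sub>v v) \<bullet>c v)"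

definition positive_semidefinite :: "complex mat \<Rightarrow> bool" where
  "positive_semidefinite A \<longleftrightarrow> hermitian A \<and>
     (\<forall>v \<in> carrier_vec (dim_row A). 0 \<le> (A *\<^sub>v v) \<bullet>c v)"

definition modulus_closed :: "complex set \<Rightarrow> bool" where
  "modulus_closed \<Omega> \<longleftrightarrow> (\<forall>z \<in> \<Omega>. complex_of_real (cmod z) \<in> \<Omega>)"

text \<open>The set \<open>\<Omega> \<inter> [0,\<infinity>)\<close>, as a set of real numbers.\<close>

definition nonneg_part :: "complex set \<Rightarrow> real set" where
  "nonneg_part \<Omega> = {x. 0 \<le> x \<and> complex_of_real x \<in> \<Omega>}"

definition pd_type :: "complex set \<Rightarrow> bool" where
  "pd_type \<Omega> \<longleftrightarrow>
     (\<forall>z \<in> \<Omega> - complex_of_real ` nonneg_part \<Omega>. \<exists>\<epsilon>>0. cmod z + \<epsilon> \<in> nonneg_part \<Omega>)"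

definition psd_type :: "complex set \<Rightarrow> bool" where
  "psd_type \<Omega> \<longleftrightarrow>
     (\<forall>z \<in> \<Omega> - complex_of_real ` nonneg_part \<Omega>. \<exists>\<delta>>0. cmod z - \<delta> \<in> nonneg_part \<Omega>)"

text \<open>
  The set of symmetric matrices in \<open>M\<^sub>n(\<Omega>)\<close>; symmetry is with respect to the plain
  transpose, without conjugation.
\<close>

definition symmetric_mats :: "nat \<Rightarrow> complex set \<Rightarrow> complex mat set" where
  "symmetric_mats n \<Omega> = {A \<in> carrier_mat n n. elements_mat A \<subseteq> \<Omega> \<and> transpose_mat A = A}"

end

theory Submission
  imports Defs
begin

text \<open>
  Repeating the last row and column of a small matrix (with a slightly larger diagonal in the
  definite case) produces a matrix of size \<open>n\<close> with the same definiteness, so only \<open>2 \<times> 2\<close> and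
  \<open>3 \<times> 3\<close> matrices matter. For \<open>a\<close> in the interior of \<open>I\<close>, subtracting the first row of
  \<open>[[a, a, a], [a, a + x, a + w], [a, a + w, a + y]]\<close> shows that \<open>F z = f (a + z) - f a\<close> compares
  \<open>F x * F y\<close> with \<open>(F w)\<^sup>2\<close> as \<open>x * y\<close> compares with \<open>w\<^sup>2\<close>. Together with monotonicity this
  forces continuity, hence \<open>F x * F y = (F w)\<^sup>2\<close> whenever \<open>x * y = w\<^sup>2\<close>. Applying this at the
  points \<open>a, a + h, \<dots>, a + 9 * h\<close> gives \<open>F (2 * h) = 2 * F h\<close>, so \<open>f\<close> is affine in the interior;
  \<open>2 \<times> 2\<close> matrices remove the constant term and reach the end points of \<open>I\<close>. For a negative
  entry \<open>- b\<close>, \<open>2 \<times> 2\<close> matrices determine \<open>\<bar>f (- b)\<bar>\<close> and a \<open>3 \<times> 3\<close> matrix with an odd number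
  of negative entries above the diagonal determines the sign.
\<close>

unbundle no vec_syntax

section \<open>Real quadratic forms\<close>

definition qform :: "nat \<Rightarrow> (nat \<Rightarrow> nat \<Rightarrow> real) \<Rightarrow> (nat \<Rightarrow> real) \<Rightarrow> real" where
  "qform n B x = (\<Sum>i<n. \<Sum>j<n. B i j * x i * x j)"

text \<open>The flag \<open>s\<close> selects the definite (\<open>True\<close>) or the semidefinite (\<open>False\<close>) version throughout.\<close>

definition form_pos :: "bool \<Rightarrow> nat \<Rightarrow> (nat \<Rightarrow> nat \<Rightarrow> real) \<Rightarrow> bool" where
  "form_pos s n B \<longleftrightarrow> (\<forall>x. (\<exists>i<n. x i \<noteq> 0) \<longrightarrow> (if s then 0 < qform n B x else 0 \<le> qform n B x))"

definition pos_mat :: "bool \<Rightarrow> complex mat \<Rightarrow> bool" where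
  "pos_mat s A \<longleftrightarrow> (if s then positive_definite A else positive_semidefinite A)"

definition real_mat :: "nat \<Rightarrow> (nat \<Rightarrow> nat \<Rightarrow> real) \<Rightarrow> complex mat" where
  "real_mat n B = mat n n (\<lambda>(i, j). complex_of_real (B i j))"

section \<open>Reduction of complex positivity to real quadratic forms\<close>

lemma real_mat_carrier: "real_mat n B \<in> carrier_mat n n"
  by (simp add: real_mat_def)

lemma hermitian_index:
  assumes "A \<in> carrier_mat n n"
  shows "hermitian A \<longleftrightarrow> (\<forall>i<n. \<forall>j<n. A $$ (i, j) = cnj (A $$ (j, i)))"
proof -
  have adj: "mat_adjoint A = mat n n (\<lambda>(i, j). cnj (A $$ (j, i)))"
    using assms by (intro eq_matI) (auto simp: mat_adjoint_def mat_of_rows_def)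
  have "hermitian A \<longleftrightarrow> (\<forall>i<n. \<forall>j<n. cnj (A $$ (j, i)) = A $$ (i, j))"
    unfolding hermitian_def adj mat_eq_iff using assms by (simp cong: conj_cong)
  then show ?thesis by (simp only: eq_commute)
qed

text \<open>The imaginary parts of the summands change sign when \<open>i\<close> and
  \<open>j\<close> are exchanged, by symmetry of \<open>B\<close>, and cancel; what remains splits
  into the forms of the real and the imaginary part.\<close>

lemma form_real_mat:
  assumes sym: "\<And>i j. i < n \<Longrightarrow> j < n \<Longrightarrow> B i j = B j i" and v: "v \<in> carrier_vec n"
  shows "(real_mat n B *\<^sub>v v) \<bullet>c v =
    complex_of_real (qform n B (\<lambda>i. Re (v $ i)) + qform n B (\<lambda>i. Im (v $ i)))"
proof -
  have 1: "(real_mat n B *\<^sub>v v) \<bullet>c v = (\<Sum>i<n. \<Sum>j<n. of_real (B i j) * v $ j * cnj (v $ i))"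
    using v by (simp add: real_mat_def scalar_prod_def sum_distrib_right atLeast0LessThan)
  have im_term: "Im (of_real (B i j) * v $ j * cnj (v $ i)) = B i j * (Re (v $ i) * Im (v $ j) - Re (v $ j) * Im (v $ i))" for i j
    by (simp add: algebra_simps)
  have "(\<Sum>i<n. \<Sum>j<n. B i j * (Re (v $ i) * Im (v $ j))) = (\<Sum>j<n. \<Sum>i<n. B i j * (Re (v $ i) * Im (v $ j)))"
    by (rule sum.swap)
  also have "\<dots> = (\<Sum>i<n. \<Sum>j<n. B i j * (Re (v $ j) * Im (v $ i)))"
    by (intro sum.cong refl) (metis lessThan_iff sym)
  finally have "(\<Sum>i<n. \<Sum>j<n. B i j * (Re (v $ i) * Im (v $ j) - Re (v $ j) * Im (v $ i))) = 0"
    unfolding right_diff_distrib sum_subtractf by simp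
  then have "Im ((real_mat n B *\<^sub>v v) \<bullet>c v) = 0"
    unfolding 1 Im_sum im_term .
  moreover have "Re ((real_mat n B *\<^sub>v v) \<bullet>c v) = qform n B (\<lambda>i. Re (v $ i)) + qform n B (\<lambda>i. Im (v $ i))"
    unfolding 1 Re_sum qform_def sum.distrib[symmetric]
    by (intro sum.cong refl) (simp add: algebra_simps)
  ultimately show ?thesis by (simp only: complex_eq_iff Re_complex_of_real Im_complex_of_real)
qed

text \<open>A nonzero complex vector has a nonzero real or imaginary part, so one of the two real
  forms meets the required bound while the other is nonnegative.\<close>

lemma pos_mat_real_mat:
  assumes sym: "\<And>i j. i < n \<Longrightarrow> j < n \<Longrightarrow> B i j = B j i"
  shows "pos_mat s (real_mat n B) \<longleftrightarrow> form_pos s n B"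
proof -
  let ?P = "\<lambda>v::complex vec. if s then 0 < (real_mat n B *\<^sub>v v) \<bullet>c v else 0 \<le> (real_mat n B *\<^sub>v v) \<bullet>c v"
  let ?Q = "\<lambda>x. if s then 0 < qform n B x else 0 \<le> qform n B x"
  have car: "real_mat n B \<in> carrier_mat n n" by (simp add: real_mat_def)
  then have dim: "dim_row (real_mat n B) = n" by simp
  have herm: "hermitian (real_mat n B)"
    unfolding hermitian_index[OF car] by (auto simp: real_mat_def sym)
  have 0: "qform n B x = 0" if "\<And>i. i < n \<Longrightarrow> x i = 0" for x
    unfolding qform_def using that by (intro sum.neutral ballI) simp
  have P: "?P v = (if s then 0 < qform n B (\<lambda>i. Re (v $ i)) + qform n B (\<lambda>i. Im (v $ i))
      else 0 \<le> qform n B (\<lambda>i. Re (v $ i)) + qform n B (\<lambda>i. Im (v $ i)))"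
    if "v \<in> carrier_vec n" for v
    using form_real_mat[OF sym that] by (simp add: less_complex_def less_eq_complex_def)
  have "pos_mat s (real_mat n B) \<longleftrightarrow> (\<forall>v \<in> carrier_vec n. v \<noteq> 0\<^sub>v n \<longrightarrow> ?P v)"
  proof (cases s)
    case True
    then show ?thesis by (simp add: pos_mat_def positive_definite_def herm dim)
  next
    case False
    \<comment> \<open>Semidefiniteness also quantifies over the zero vector, which
      \<open>form_pos\<close> leaves out.\<close>
    have "0 \<le> (real_mat n B *\<^sub>v 0\<^sub>v n) \<bullet>c 0\<^sub>v n"
      using form_real_mat[OF sym zero_carrier_vec] by (simp add: 0)
    then show ?thesis using False
      by (auto simp: pos_mat_def positive_semidefinite_def herm dim)
  qed
  also have "\<dots> \<longleftrightarrow> form_pos s n B"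
  proof
    assume R: "form_pos s n B"
    show "\<forall>v \<in> carrier_vec n. v \<noteq> 0\<^sub>v n \<longrightarrow> ?P v"
    proof (intro ballI impI)
      fix v :: "complex vec" assume v: "v \<in> carrier_vec n" "v \<noteq> 0\<^sub>v n"
      then obtain i where i: "i < n" "v $ i \<noteq> 0" by (auto simp: vec_eq_iff)
      have nn: "0 \<le> qform n B x" for x
        by (cases "\<exists>i<n. x i \<noteq> 0") (use R 0[of x] in \<open>auto simp: form_pos_def split: if_splits intro: less_imp_le\<close>)
      from i(2) consider "Re (v $ i) \<noteq> 0" | "Im (v $ i) \<noteq> 0" by (auto simp: complex_eq_iff)
      then have "?Q (\<lambda>i. Re (v $ i)) \<or> ?Q (\<lambda>i. Im (v $ i))"
      proof cases
        case 1
        then have "\<exists>i<n. Re (v $ i) \<noteq> 0" using i(1) by blast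
        then show ?thesis using R[unfolded form_pos_def, rule_format, of "\<lambda>i. Re (v $ i)"] by simp
      next
        case 2
        then have "\<exists>i<n. Im (v $ i) \<noteq> 0" using i(1) by blast
        then show ?thesis using R[unfolded form_pos_def, rule_format, of "\<lambda>i. Im (v $ i)"] by simp
      qed
      then show "?P v" unfolding P[OF v(1)] using nn[of "\<lambda>i. Re (v $ i)"] nn[of "\<lambda>i. Im (v $ i)"]
        by (auto split: if_splits)
    qed
  next
    assume L: "\<forall>v \<in> carrier_vec n. v \<noteq> 0\<^sub>v n \<longrightarrow> ?P v"
    show "form_pos s n B"
      unfolding form_pos_def
    proof (intro allI impI)
      fix x :: "nat \<Rightarrow> real" assume "\<exists>i<n. x i \<noteq> 0"
      then have ne: "vec n (\<lambda>i. complex_of_real (x i)) \<noteq> 0\<^sub>v n" by (auto simp: vec_eq_iff)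
      have "qform n B (\<lambda>i. Re (vec n (\<lambda>i. complex_of_real (x i)) $ i)) = qform n B x"
        unfolding qform_def by (intro sum.cong) auto
      moreover have "qform n B (\<lambda>i. Im (vec n (\<lambda>i. complex_of_real (x i)) $ i)) = 0"
        by (rule 0) simp
      ultimately show "?Q x"
        using L[rule_format, OF vec_carrier ne] unfolding P[OF vec_carrier] by (simp split: if_splits)
    qed
  qed
  finally show ?thesis .
qed

section \<open>Enlargement of a small matrix to size \<open>n\<close>\<close>

definition inflate :: "nat \<Rightarrow> real \<Rightarrow> (nat \<Rightarrow> nat \<Rightarrow> real) \<Rightarrow> nat \<Rightarrow> nat \<Rightarrow> real" where
  "inflate m e B i j = B (min i (m - 1)) (min j (m - 1)) + (if i = j \<and> m \<le> i then e else 0)"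

text \<open>Repeated rows see only the sum of the coordinates that share an index, so the form
  collapses to that of \<open>B\<close> at the grouped vector; the diagonal surplus contributes the
  squares.\<close>

lemma qform_inflate:
  assumes "0 < m" "m \<le> n"
  shows "qform n (inflate m e B) x =
    qform m B (\<lambda>k. \<Sum>i | i < n \<and> min i (m - 1) = k. x i) + e * (\<Sum>i=m..<n. (x i)\<^sup>2)"
proof -
  let ?p = "\<lambda>i. min i (m - 1)"
  define y where "y = (\<lambda>k. \<Sum>i | i < n \<and> ?p i = k. x i)"
  \<comment> \<open>Grouping for a single linear sum, applied first to the inner sum over
    \<open>j\<close> and then to the outer one over \<open>i\<close>.\<close>
  have grp: "(\<Sum>i<n. h (?p i) * x i) = (\<Sum>k<m. h k * (\<Sum>i | i < n \<and> ?p i = k. x i))" for h :: "nat \<Rightarrow> real"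
  proof -
    have "(\<Sum>k<m. \<Sum>i\<in>{i\<in>{..<n}. ?p i = k}. h (?p i) * x i) = (\<Sum>i<n. h (?p i) * x i)"
      using assms by (intro sum.group) auto
    moreover have "(\<Sum>i\<in>{i\<in>{..<n}. ?p i = k}. h (?p i) * x i) = h k * (\<Sum>i | i < n \<and> ?p i = k. x i)" for k
      unfolding sum_distrib_left by (intro sum.cong) auto
    ultimately show ?thesis by simp
  qed
  have "qform n (inflate m e B) x =
      (\<Sum>i<n. \<Sum>j<n. B (?p i) (?p j) * x i * x j)
      + (\<Sum>i<n. \<Sum>j<n. if i = j \<and> m \<le> i then e * x i * x j else 0)"
    unfolding qform_def inflate_def sum.distrib[symmetric]
    by (intro sum.cong refl) (simp add: algebra_simps)
  also have "(\<Sum>i<n. \<Sum>j<n. if i = j \<and> m \<le> i then e * x i * x j else 0) = (\<Sum>i<n. if m \<le> i then e * (x i)\<^sup>2 else 0)"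
  proof (intro sum.cong refl)
    fix i assume i: "i \<in> {..<n}"
    have "(\<Sum>j<n. if i = j \<and> m \<le> i then e * x i * x j else 0) = (\<Sum>j<n. if i = j then (if m \<le> i then e * x i * x i else 0) else 0)"
      by (intro sum.cong refl) simp
    also have "\<dots> = (if m \<le> i then e * x i * x i else 0)" using i by simp
    finally show "(\<Sum>j<n. if i = j \<and> m \<le> i then e * x i * x j else 0) = (if m \<le> i then e * (x i)\<^sup>2 else 0)"
      by (simp add: power2_eq_square)
  qed
  also have "\<dots> = e * (\<Sum>i=m..<n. (x i)\<^sup>2)"
    unfolding sum_distrib_left by (rule sum.mono_neutral_cong_right) auto
  also have "(\<Sum>i<n. \<Sum>j<n. B (?p i) (?p j) * x i * x j) = (\<Sum>i<n. (\<Sum>j<n. B (?p i) (?p j) * x j) * x i)"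
    unfolding sum_distrib_right by (intro sum.cong refl) simp
  also have "\<dots> = (\<Sum>i<n. (\<Sum>l<m. B (?p i) l * y l) * x i)"
    unfolding y_def by (subst grp) (rule refl)
  also have "\<dots> = (\<Sum>k<m. (\<Sum>l<m. B k l * y l) * y k)"
    unfolding y_def by (rule grp)
  also have "\<dots> = qform m B y"
    unfolding qform_def sum_distrib_right by (intro sum.cong refl) simp
  finally show ?thesis unfolding y_def .
qed

text \<open>The surplus starts only at index \<open>m\<close>, so the leading block is
  \<open>B\<close> itself and padding \<open>x\<close> with zeros works for a surplus
  \<open>e\<close> of any sign.\<close>

lemma form_pos_inflate_imp:
  assumes "0 < m" "m \<le> n" "form_pos s n (inflate m e B)"
  shows "form_pos s m B"
  unfolding form_pos_def
proof (intro allI impI)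
  fix x :: "nat \<Rightarrow> real" assume x: "\<exists>i<m. x i \<noteq> 0"
  let ?y = "\<lambda>i. if i < m then x i else 0"
  have "(\<Sum>i | i < n \<and> min i (m - 1) = k. ?y i) = x k" if "k < m" for k
  proof -
    have "(\<Sum>i | i < n \<and> min i (m - 1) = k. ?y i) = (\<Sum>i\<in>{k}. x i)"
      using assms(1,2) that by (intro sum.mono_neutral_cong_right) auto
    then show ?thesis by simp
  qed
  then have "qform n (inflate m e B) ?y = qform m B x"
    unfolding qform_inflate[OF assms(1,2)] by (simp add: qform_def)
  moreover have "\<exists>i<n. ?y i \<noteq> 0" using x assms(2) by (auto intro: less_le_trans)
  ultimately show "if s then 0 < qform m B x else 0 \<le> qform m B x"
    using assms(3)[unfolded form_pos_def, rule_format, of ?y] by (cases s) simp_all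
qed

text \<open>If the grouped vector is nonzero, \<open>B\<close> decides. If it vanishes,
  \<open>x\<close> cannot be supported below \<open>m\<close>, since grouping would then return
  \<open>x\<close>; so the squares from \<open>m\<close> on have a positive sum and \<open>e\<close>
  decides.\<close>

lemma form_pos_inflate:
  assumes "0 < m" "m \<le> n" "form_pos s m B" "if s then 0 < e else e = 0"
  shows "form_pos s n (inflate m e B)"
  unfolding form_pos_def
proof (intro allI impI)
  fix x :: "nat \<Rightarrow> real" assume x: "\<exists>i<n. x i \<noteq> 0"
  define y where "y = (\<lambda>k. \<Sum>i | i < n \<and> min i (m - 1) = k. x i)"
  have q: "qform n (inflate m e B) x = qform m B y + e * (\<Sum>i=m..<n. (x i)\<^sup>2)"
    unfolding y_def by (rule qform_inflate) fact+
  have e0: "0 \<le> e * (\<Sum>i=m..<n. (x i)\<^sup>2)"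
    using assms(4) by (auto split: if_splits intro!: mult_nonneg_nonneg sum_nonneg)
  show "if s then 0 < qform n (inflate m e B) x else 0 \<le> qform n (inflate m e B) x"
  proof (cases "\<exists>k<m. y k \<noteq> 0")
    case True
    then show ?thesis using assms(3) e0 unfolding form_pos_def q by (auto split: if_splits intro: add_pos_nonneg)
  next
    case False
    then have "qform m B y = 0" by (simp add: qform_def)
    moreover have "0 < (\<Sum>i=m..<n. (x i)\<^sup>2)"
    proof (rule ccontr)
      assume "\<not> ?thesis"
      then have "(\<Sum>i=m..<n. (x i)\<^sup>2) = 0" by (meson sum_nonneg zero_le_power2 less_eq_real_def not_less order.antisym)
      then have z: "x i = 0" if "m \<le> i" "i < n" for i
        using that by (subst (asm) sum_nonneg_eq_0_iff) auto
      have "x k = 0" if "k < m" for k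
      proof -
        have "y k = (\<Sum>i\<in>{k}. x i)" unfolding y_def
          using assms(1,2) that z by (intro sum.mono_neutral_right) (auto simp: min_def split: if_splits)
        then show ?thesis using False that by simp
      qed
      then show False using x z by (meson not_le)
    qed
    ultimately show ?thesis unfolding q using assms(4) by auto
  qed
qed

section \<open>Functions with a geometric mean property\<close>

lemma left_limit_le:
  fixes g :: "real \<Rightarrow> real"
  assumes "isCont g w" "0 < e" "\<And>v. w - e < v \<Longrightarrow> v < w \<Longrightarrow> g v \<le> c"
  shows "g w \<le> c"
proof (rule tendsto_upperbound)
  show "(g \<longlongrightarrow> g w) (at_left w)"
    using assms(1) by (simp add: isCont_def filterlim_at_split)
  show "\<forall>\<^sub>F v in at_left w. g v \<le> c"
    using eventually_at_left_real[of "w - e" w] assms(2,3) by (auto elim: eventually_mono)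
qed simp

lemma right_limit_ge:
  fixes g :: "real \<Rightarrow> real"
  assumes "isCont g w" "0 < e" "\<And>v. w < v \<Longrightarrow> v < w + e \<Longrightarrow> c \<le> g v"
  shows "c \<le> g w"
proof (rule tendsto_lowerbound)
  show "(g \<longlongrightarrow> g w) (at_right w)"
    using assms(1) by (simp add: isCont_def filterlim_at_split)
  show "\<forall>\<^sub>F v in at_right w. c \<le> g v"
    using eventually_at_right_real[of w "w + e"] assms(2,3) by (auto elim: eventually_mono)
qed simp

text \<open>At the leftmost point where a positive maximum is attained, the midpoint identity would
  make \<open>c - h\<close> a maximum point as well. The step \<open>h\<close> may depend on
  \<open>c\<close>, which suits \<open>chord\<close>.\<close>

lemma locally_midpoint_affine_le_zero:
  fixes g :: "real \<Rightarrow> real"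
  assumes cont: "continuous_on {a..b} g" and "a \<le> b" and ends: "g a = 0" "g b = 0"
    and mid: "\<And>c. a < c \<Longrightarrow> c < b \<Longrightarrow> \<exists>h>0. a \<le> c - h \<and> c + h \<le> b \<and> g (c - h) + g (c + h) = 2 * g c"
    and x: "x \<in> {a..b}"
  shows "g x \<le> 0"
proof (rule ccontr)
  assume "\<not> g x \<le> 0"
  obtain m where m: "m \<in> {a..b}" "\<And>y. y \<in> {a..b} \<Longrightarrow> g y \<le> g m"
    using continuous_attains_sup[OF compact_Icc _ cont] \<open>a \<le> b\<close> by auto
  with x \<open>\<not> g x \<le> 0\<close> have gm: "0 < g m" by force
  let ?S = "{a..b} \<inter> g -` {g m}"
  have "closed ?S" using cont by (intro continuous_closed_preimage) auto
  then have "compact ({a..b} \<inter> ?S)" by (rule compact_Int_closed[OF compact_Icc])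
  then have "compact ?S" by (simp flip: Int_assoc)
  moreover have "?S \<noteq> {}" using m by auto
  ultimately obtain c where c: "c \<in> ?S" "\<And>y. y \<in> ?S \<Longrightarrow> c \<le> y"
    using compact_attains_inf by metis
  have gc: "a \<le> c" "c \<le> b" "g c = g m" using c(1) by simp_all
  have "c \<noteq> a" "c \<noteq> b" using gc(3) gm ends by force+
  then obtain h where h: "0 < h" "a \<le> c - h" "c + h \<le> b" "g (c - h) + g (c + h) = 2 * g c"
    using mid[of c] gc(1,2) by fastforce
  have "c - h \<in> {a..b}" "c + h \<in> {a..b}" using h gc(1,2) by simp_all
  then have le: "g (c - h) \<le> g m" "g (c + h) \<le> g m" by (simp_all only: m(2))
  have "g (c - h) \<noteq> g m"
  proof
    assume "g (c - h) = g m"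
    then have "c \<le> c - h" using \<open>c - h \<in> {a..b}\<close> by (intro c(2)) simp
    then show False using h(1) by simp
  qed
  then show False using le h(4) gc(3) by linarith
qed

text \<open>
  Here \<open>s, r, f4, \<dots>, f9\<close> are the values of \<open>(f (a + k * h) - f a) / (f (a + h) - f a)\<close> for
  \<open>k = 2, 3, 4, \<dots>, 9\<close>; the assumptions \<open>e\<close>, \<open>e1\<close>, \<open>e2\<close>, \<open>e4\<close> are geometric mean identities
  based at \<open>a\<close>, \<open>a + h\<close>, \<open>a + 2 * h\<close> and \<open>a + 4 * h\<close>.
\<close>

lemma ratio_eq_2:
  fixes s :: real
  assumes s: "1 < s" and r: "0 < r" and f6: "0 < f6"
    and e: "f4 = s\<^sup>2" "s * f8 = f4\<^sup>2" "f9 = r\<^sup>2" "f4 * f9 = f6\<^sup>2"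
    and e1: "(s - 1) * (f5 - 1) = (r - 1)\<^sup>2"
    and e2: "(r - s) * (f6 - s) = (f4 - s)\<^sup>2"
    and e4: "(f5 - f4) * (f8 - f4) = (f6 - f4)\<^sup>2"
  shows "s = 2"
proof -
  have "f6\<^sup>2 = (s * r)\<^sup>2" using e by (simp add: power_mult_distrib)
  then have f6: "f6 = s * r" using s r f6 by (simp add: power2_eq_iff_nonneg)
  have f8: "f8 = s^3" using e(1,2) s by (simp add: power2_eq_square power3_eq_cube)
  have "s * ((r - s) * (r - 1)) = s * (s * (s - 1)\<^sup>2)"
    using e2 unfolding e(1) f6 by (simp add: power2_eq_square algebra_simps)
  then have A: "(r - s) * (r - 1) = s * (s - 1)\<^sup>2" using s by simp
  have "s\<^sup>2 * ((f5 - s\<^sup>2) * (s - 1)) = s\<^sup>2 * (r - s)\<^sup>2"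
    using e4 unfolding e(1) f6 f8 by (simp add: power2_eq_square power3_eq_cube algebra_simps)
  then have "(f5 - s\<^sup>2) * (s - 1) = (r - s)\<^sup>2" using s by simp
  \<comment> \<open>These rearrangements subtract the identity based at \<open>a + 4 * h\<close>
    from \<open>e1\<close>; this eliminates \<open>f5\<close> and leaves a relation between
    \<open>s\<close> and \<open>r\<close>.\<close>
  moreover have "(s - 1) * (f5 - 1) = (f5 - s\<^sup>2) * (s - 1) + (s - 1) * (s\<^sup>2 - 1)"
    by (simp add: algebra_simps)
  moreover have "(r - 1)\<^sup>2 = (r - s)\<^sup>2 + (s - 1) * (2 * r - 1 - s)"
    by (simp add: power2_eq_square algebra_simps)
  ultimately have "(s - 1) * (s\<^sup>2 - 1) = (s - 1) * (2 * r - 1 - s)" using e1 by linarith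
  then have "s\<^sup>2 - 1 = 2 * r - 1 - s" using s by simp
  then have r2: "2 * r = s\<^sup>2 + s" by linarith
  \<comment> \<open>Inserting \<open>r2\<close> into \<open>A\<close> gives an equation in
    \<open>s\<close> alone, from which the nonzero factor \<open>s * (s - 1)\<^sup>2\<close>
    cancels.\<close>
  have "4 * (s * (s - 1)\<^sup>2) = (2 * r - 2 * s) * (2 * r - 2)" using A by (simp add: algebra_simps)
  also have "\<dots> = (s * (s - 1)\<^sup>2) * (s + 2)"
    unfolding r2 by (simp add: power2_eq_square algebra_simps)
  finally have "(s * (s - 1)\<^sup>2) * (s + 2) = (s * (s - 1)\<^sup>2) * 4" by linarith
  moreover have "s * (s - 1)\<^sup>2 \<noteq> 0" using s by simp
  ultimately have "s + 2 = 4" by (simp only: mult_cancel_left) simp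
  then show ?thesis by simp
qed

section \<open>The interior of a nondegenerate interval\<close>

locale nonneg_interval =
  fixes I :: "real set"
  assumes I_interval: "\<And>a b x. a \<in> I \<Longrightarrow> b \<in> I \<Longrightarrow> a \<le> x \<Longrightarrow> x \<le> b \<Longrightarrow> x \<in> I"
    and I_nonneg: "\<And>x. x \<in> I \<Longrightarrow> 0 \<le> x"
    and nondegenerate: "\<exists>a\<in>I. \<exists>b\<in>I. a < b"
begin

text \<open>The interior of \<open>I\<close>, phrased by points of \<open>I\<close> on both sides so
  that positivity and room in both directions can be read off.\<close>

definition J :: "real set" where
  "J = {x. \<exists>a\<in>I. \<exists>b\<in>I. a < x \<and> x < b}"

lemma J_E:
  assumes "x \<in> J"
  obtains a b where "a \<in> I" "b \<in> I" "a < x" "x < b"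
  using assms unfolding J_def by blast

lemma J_between_I: "x \<in> I \<Longrightarrow> y \<in> I \<Longrightarrow> x < z \<Longrightarrow> z < y \<Longrightarrow> z \<in> J"
  unfolding J_def by blast

lemma J_I: "x \<in> J \<Longrightarrow> x \<in> I"
  by (erule J_E) (blast intro: I_interval less_imp_le)

lemma J_pos: "x \<in> J \<Longrightarrow> 0 < x"
  by (erule J_E) (drule I_nonneg, simp)

lemma J_between:
  assumes "x \<in> J" "y \<in> J" "x \<le> z" "z \<le> y"
  shows "z \<in> J"
proof -
  obtain a where "a \<in> I" "a < x" using assms(1) by (rule J_E)
  moreover obtain b where "b \<in> I" "y < b" using assms(2) by (rule J_E)
  ultimately show ?thesis using assms(3,4) by (intro J_between_I[of a b]) auto
qed

lemma J_nbhd: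
  assumes "x \<in> J"
  obtains e where "0 < e" "\<And>v. x - e \<le> v \<Longrightarrow> v \<le> x + e \<Longrightarrow> v \<in> J"
proof -
  from assms obtain a b where ab: "a \<in> I" "b \<in> I" "a < x" "x < b" unfolding J_def by blast
  define e where "e = min (x - a) (b - x) / 2"
  have e: "0 < e" "e < x - a" "e < b - x" using ab by (auto simp: e_def min_def)
  have "v \<in> J" if "x - e \<le> v" "v \<le> x + e" for v
    using that ab e by (intro J_between_I[of a b]) auto
  moreover note e(1)
  ultimately show ?thesis using that by blast
qed

lemma J_two: obtains p q where "p \<in> J" "q \<in> J" "p < q"
proof -
  from nondegenerate obtain a b where ab: "a \<in> I" "b \<in> I" "a < b" by blast
  have "(2 * a + b) / 3 \<in> J" "(a + 2 * b) / 3 \<in> J"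
    using ab by (auto intro!: J_between_I[of a b])
  then show ?thesis using ab by (intro that[of "(2 * a + b) / 3" "(a + 2 * b) / 3"]) auto
qed

end

text \<open>Arguments are compared strictly and values weakly, which is what the definite and the
  semidefinite version have in common. The point belonging to \<open>y\<close> is interior because
  it becomes the diagonal entry to be enlarged; in the \<open>two_\<close> hypotheses
  \<open>x\<close> may be an end point, and in \<open>two_lower\<close> also
  \<open>w\<close>.\<close>

locale geometric_mean = nonneg_interval +
  fixes \<phi> :: "real \<Rightarrow> real"
  assumes strict: "\<And>x y. x \<in> J \<Longrightarrow> y \<in> J \<Longrightarrow> x < y \<Longrightarrow> \<phi> x < \<phi> y"
    and pos: "\<And>x. x \<in> J \<Longrightarrow> 0 < \<phi> x"
    and three_lower: "\<And>a x y w. \<lbrakk>a \<in> J; a + x \<in> J; a + y \<in> J; a + w \<in> J; 0 < x; 0 < y; 0 < w; w\<^sup>2 < x * y\<rbrakk>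
      \<Longrightarrow> (\<phi> (a + w) - \<phi> a)\<^sup>2 \<le> (\<phi> (a + x) - \<phi> a) * (\<phi> (a + y) - \<phi> a)"
    and three_upper: "\<And>a x y w. \<lbrakk>a \<in> J; a + x \<in> J; a + y \<in> J; a + w \<in> J; 0 < x; 0 < y; 0 < w; x * y < w\<^sup>2\<rbrakk>
      \<Longrightarrow> (\<phi> (a + x) - \<phi> a) * (\<phi> (a + y) - \<phi> a) \<le> (\<phi> (a + w) - \<phi> a)\<^sup>2"
    and two_lower: "\<And>x y w. \<lbrakk>x \<in> I; y \<in> J; w \<in> I; w\<^sup>2 < x * y\<rbrakk> \<Longrightarrow> (\<phi> w)\<^sup>2 \<le> \<phi> x * \<phi> y"
    and two_upper: "\<And>x y w. \<lbrakk>x \<in> I; y \<in> J; w \<in> J; x * y < w\<^sup>2\<rbrakk> \<Longrightarrow> \<phi> x * \<phi> y \<le> (\<phi> w)\<^sup>2"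
begin

lemma mono_J: "x \<in> J \<Longrightarrow> y \<in> J \<Longrightarrow> x \<le> y \<Longrightarrow> \<phi> x \<le> \<phi> y"
  using strict[of x y] by (cases "x = y") auto

text \<open>A monotone function can only jump, from \<open>L\<close> to \<open>R\<close>. In
  \<open>three_upper\<close>, based at \<open>a\<close> left of \<open>x0\<close>, let
  \<open>a + x\<close> and \<open>a + w\<close> lie left of \<open>x0\<close> and
  \<open>a + y\<close> right of it; in the limit
  \<open>(L - \<phi> a) * (R - \<phi> a) \<le> (L - \<phi> a)\<^sup>2\<close>, so there is no
  jump.\<close>

lemma isCont_J:
  assumes x0: "x0 \<in> J"
  shows "isCont \<phi> x0"
proof -
  obtain d where d: "0 < d" and dJ: "\<And>v. x0 - d \<le> v \<Longrightarrow> v \<le> x0 + d \<Longrightarrow> v \<in> J"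
    using J_nbhd[OF x0] by blast
  define a where "a = x0 - d"
  have aJ: "a \<in> J" and x0a: "x0 = a + d" using dJ[of a] d by (auto simp: a_def)
  define L where "L = Sup (\<phi> ` {a<..<x0})"
  define R where "R = Inf (\<phi> ` {x0<..<x0 + d})"
  have bddL: "bdd_above (\<phi> ` {a<..<x0})"
    by (rule bdd_aboveI2[of _ _ "\<phi> x0"]) (use dJ d in \<open>auto intro!: mono_J x0 simp: a_def\<close>)
  have bddR: "bdd_below (\<phi> ` {x0<..<x0 + d})"
    by (rule bdd_belowI2[of _ "\<phi> x0"]) (use dJ d in \<open>auto intro!: mono_J x0\<close>)
  have neL: "\<phi> ` {a<..<x0} \<noteq> {}" and neR: "\<phi> ` {x0<..<x0 + d} \<noteq> {}" using d by (auto simp: a_def)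
  have L: "\<phi> v \<le> L" if "a < v" "v < x0" for v
    unfolding L_def using that by (intro cSup_upper bddL) auto
  have R: "R \<le> \<phi> v" if "x0 < v" "v < x0 + d" for v
    unfolding R_def using that by (intro cInf_lower bddR) auto
  have Lx: "L \<le> \<phi> x0" unfolding L_def
    by (rule cSup_least[OF neL]) (use dJ d in \<open>auto intro!: mono_J x0 simp: a_def\<close>)
  have xR: "\<phi> x0 \<le> R" unfolding R_def
    by (rule cInf_greatest[OF neR]) (use dJ d in \<open>auto intro!: mono_J x0\<close>)
  have aL: "\<phi> a < L"
    using L[of "a + d / 2"] strict[OF aJ, of "a + d / 2"] dJ[of "a + d / 2"] d by (auto simp: a_def)
  have key: "(\<phi> v - \<phi> a) * (R - \<phi> a) \<le> (L - \<phi> a)\<^sup>2" if v: "a < v" "v < x0" for v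
  proof -
    define x where "x = v - a"
    have x: "0 < x" "x < d" using v by (auto simp: x_def x0a)
    have "sqrt (x * d) < sqrt (d * d)" using x d by (intro real_sqrt_less_mono) simp
    then have "sqrt (x * d) < d" using d by (simp only: real_sqrt_abs2 abs_of_pos)
    then obtain w where w: "sqrt (x * d) < w" "w < d" using dense by blast
    have "0 < sqrt (x * d)" using x d by simp
    then have w0: "0 < w" using w(1) by linarith
    have "(sqrt (x * d))\<^sup>2 < w\<^sup>2" using w(1) x d by (intro power_strict_mono) auto
    then have w2: "x * d < w\<^sup>2" using x d by simp
    \<comment> \<open>The number \<open>y\<close> slightly exceeds \<open>d\<close>, so that
      \<open>a + y\<close> is right of \<open>x0\<close>; the bound \<open>2 * d\<close> keeps it in
      the neighbourhood, and \<open>w\<^sup>2 / x\<close> keeps \<open>x * y\<close> below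
      \<open>w\<^sup>2\<close>.\<close>
    then have "d < min (2 * d) (w\<^sup>2 / x)" using x d by (simp add: field_simps)
    then obtain y where y: "d < y" "y < 2 * d" "y < w\<^sup>2 / x" using dense by (metis min_less_iff_conj)
    have "x * y < w\<^sup>2" using y(3) x by (simp add: field_simps)
    then have "(\<phi> (a + x) - \<phi> a) * (\<phi> (a + y) - \<phi> a) \<le> (\<phi> (a + w) - \<phi> a)\<^sup>2"
      using x y w w0 d aJ by (intro three_upper dJ) (auto simp: a_def)
    also have "\<dots> \<le> (L - \<phi> a)\<^sup>2"
    proof (rule power_mono)
      show "\<phi> (a + w) - \<phi> a \<le> L - \<phi> a" using L[of "a + w"] w w0 x0a by simp
      show "0 \<le> \<phi> (a + w) - \<phi> a" using mono_J[OF aJ, of "a + w"] dJ[of "a + w"] w w0 by (simp add: a_def)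
    qed
    finally have 1: "(\<phi> (a + x) - \<phi> a) * (\<phi> (a + y) - \<phi> a) \<le> (L - \<phi> a)\<^sup>2" .
    have "R - \<phi> a \<le> \<phi> (a + y) - \<phi> a" using R[of "a + y"] y x0a by simp
    moreover have "0 \<le> \<phi> (a + x) - \<phi> a" using mono_J[OF aJ, of "a + x"] dJ[of "a + x"] x by (simp add: a_def)
    ultimately have "(\<phi> (a + x) - \<phi> a) * (R - \<phi> a) \<le> (\<phi> (a + x) - \<phi> a) * (\<phi> (a + y) - \<phi> a)"
      by (rule mult_left_mono)
    with 1 show ?thesis by (simp add: x_def)
  qed
  have Ra: "0 < R - \<phi> a" using aL Lx xR by simp
  \<comment> \<open>Solved for \<open>\<phi> v\<close>, \<open>key\<close> gives a bound independent
    of \<open>v\<close>, which passes to the supremum.\<close>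
  have "L \<le> \<phi> a + (L - \<phi> a)\<^sup>2 / (R - \<phi> a)" unfolding L_def
    by (rule cSup_least[OF neL]) (use key Ra in \<open>auto simp: field_simps L_def[symmetric]\<close>)
  then have "(L - \<phi> a) * (R - \<phi> a) \<le> (L - \<phi> a) * (L - \<phi> a)"
    using Ra by (simp add: field_simps power2_eq_square)
  then have "R \<le> L" using aL by (simp add: mult_le_cancel_left)
  then have LR: "L = \<phi> x0" "R = \<phi> x0" using Lx xR by auto
  show ?thesis
    unfolding isCont_def
  proof (rule order_tendstoI)
    fix t assume "t < \<phi> x0"
    then obtain v where v: "a < v" "v < x0" "t < \<phi> v"
      using less_cSup_iff[OF neL bddL, of t] LR L_def by auto
    have "\<forall>\<^sub>F z in nhds x0. z \<in> {v<..<x0 + d}"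
      using v d by (intro eventually_nhds_in_open) auto
    then have "\<forall>\<^sub>F z in nhds x0. t < \<phi> z"
    proof eventually_elim
      case (elim z)
      then show ?case using mono_J[of v z] dJ[of v] dJ[of z] v by (auto simp: a_def)
    qed
    then show "\<forall>\<^sub>F z in at x0. t < \<phi> z" by (auto simp: eventually_at_filter elim: eventually_mono)
  next
    fix t assume "\<phi> x0 < t"
    then obtain v where v: "x0 < v" "v < x0 + d" "\<phi> v < t"
      using cInf_less_iff[OF neR bddR, of t] LR R_def by auto
    have "\<forall>\<^sub>F z in nhds x0. z \<in> {a<..<v}"
      using v d by (intro eventually_nhds_in_open) (auto simp: a_def)
    then have "\<forall>\<^sub>F z in nhds x0. \<phi> z < t"
    proof eventually_elim
      case (elim z)
      then show ?case using mono_J[of z v] dJ[of v] dJ[of z] v by (auto simp: a_def)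
    qed
    then show "\<forall>\<^sub>F z in at x0. \<phi> z < t" by (auto simp: eventually_at_filter elim: eventually_mono)
  qed
qed

text \<open>By continuity \<open>w\<close> can be approached from above, where
  \<open>three_upper\<close> applies, and from below, where \<open>three_lower\<close> does.\<close>

lemma three_eq:
  assumes aJ: "a \<in> J" and J: "a + x \<in> J" "a + y \<in> J" and x: "0 < x" "0 < y" "0 < w" and w: "w\<^sup>2 = x * y"
  shows "(\<phi> (a + x) - \<phi> a) * (\<phi> (a + y) - \<phi> a) = (\<phi> (a + w) - \<phi> a)\<^sup>2"
proof -
  have "w \<le> max x y"
  proof (rule power2_le_imp_le)
    have "x * y \<le> max x y * max x y" using x by (intro mult_mono) auto
    then show "w\<^sup>2 \<le> (max x y)\<^sup>2" by (simp add: w power2_eq_square[of "max x y"])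
  qed (use x in auto)
  then have "a + w \<in> J" using J_between[OF aJ, of "a + max x y" "a + w"] J x by (auto simp: max_def split: if_splits)
  then obtain e where e: "0 < e" "\<And>v. a + w - e \<le> v \<Longrightarrow> v \<le> a + w + e \<Longrightarrow> v \<in> J"
    using J_nbhd by blast
  have cont: "isCont (\<lambda>v. (\<phi> (a + v) - \<phi> a)\<^sup>2) w"
    using isCont_J[OF \<open>a + w \<in> J\<close>] by (intro continuous_intros isCont_o2[where g = \<phi> and f = "\<lambda>v. a + v"])
  show ?thesis
  proof (rule antisym)
    show "(\<phi> (a + x) - \<phi> a) * (\<phi> (a + y) - \<phi> a) \<le> (\<phi> (a + w) - \<phi> a)\<^sup>2"
    proof (rule right_limit_ge[OF cont e(1)])
      fix v assume "w < v" "v < w + e"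
      then show "(\<phi> (a + x) - \<phi> a) * (\<phi> (a + y) - \<phi> a) \<le> (\<phi> (a + v) - \<phi> a)\<^sup>2"
        using x aJ J e(2)[of "a + v"] by (intro three_upper) (auto simp: w[symmetric] intro!: power_strict_mono)
    qed
    show "(\<phi> (a + w) - \<phi> a)\<^sup>2 \<le> (\<phi> (a + x) - \<phi> a) * (\<phi> (a + y) - \<phi> a)"
    \<comment> \<open>The minimum with \<open>w\<close> keeps the approximating \<open>v\<close>
      positive, as \<open>three_lower\<close> demands.\<close>
    proof (rule left_limit_le[OF cont, of "min e w"])
      fix v assume "w - min e w < v" "v < w"
      then show "(\<phi> (a + v) - \<phi> a)\<^sup>2 \<le> (\<phi> (a + x) - \<phi> a) * (\<phi> (a + y) - \<phi> a)"
        using x aJ J e(2)[of "a + v"] by (intro three_lower) (auto simp: w[symmetric] intro!: power_strict_mono)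
    qed (use e x in auto)
  qed
qed

text \<open>The same two-sided limit with base point zero. The geometric mean equals
  \<open>y\<close> or lies strictly between \<open>x\<close> and \<open>y\<close>, so it is interior
  even if \<open>x\<close> is an end point.\<close>

lemma two_eq:
  assumes x: "x \<in> I" "0 < x" and y: "y \<in> J"
  shows "sqrt (x * y) \<in> J" "\<phi> x * \<phi> y = (\<phi> (sqrt (x * y)))\<^sup>2"
proof -
  define w where "w = sqrt (x * y)"
  have y0: "0 < y" using y by (rule J_pos)
  have w0: "0 < w" and w: "w\<^sup>2 = x * y" using x y0 by (auto simp: w_def)
  have wJ: "w \<in> J"
  proof -
    consider "x = y" | "x < y" | "y < x" by linarith
    then show ?thesis
    proof cases
      case 1
      then show ?thesis using y y0 by (simp add: w_def)
    next
      case 2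
      then have "x\<^sup>2 < w\<^sup>2" "w\<^sup>2 < y\<^sup>2" unfolding w using x y0 by (auto simp: power2_eq_square)
      then have "x < w" "w < y" using w0 x y0 by (auto intro: power2_less_imp_less)
      then show ?thesis using x J_I[OF y] by (intro J_between_I[of x y])
    next
      case 3
      then have "y\<^sup>2 < w\<^sup>2" "w\<^sup>2 < x\<^sup>2" unfolding w using x y0 by (auto simp: power2_eq_square)
      then have "y < w" "w < x" using w0 x y0 by (auto intro: power2_less_imp_less)
      then show ?thesis using x J_I[OF y] by (intro J_between_I[of y x])
    qed
  qed
  then obtain e where e: "0 < e" "\<And>v. w - e \<le> v \<Longrightarrow> v \<le> w + e \<Longrightarrow> v \<in> J"
    using J_nbhd by blast
  have cont: "isCont (\<lambda>v. (\<phi> v)\<^sup>2) w" using isCont_J[OF wJ] by (intro continuous_intros)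
  have "\<phi> x * \<phi> y = (\<phi> w)\<^sup>2"
  proof (rule antisym)
    show "\<phi> x * \<phi> y \<le> (\<phi> w)\<^sup>2"
    proof (rule right_limit_ge[OF cont e(1)])
      fix v assume "w < v" "v < w + e"
      then show "\<phi> x * \<phi> y \<le> (\<phi> v)\<^sup>2"
        using x y w0 e(2)[of v] by (intro two_upper) (auto simp: w[symmetric] intro!: power_strict_mono)
    qed
    show "(\<phi> w)\<^sup>2 \<le> \<phi> x * \<phi> y"
    proof (rule left_limit_le[OF cont, of "min e w"])
      fix v assume "w - min e w < v" "v < w"
      then show "(\<phi> v)\<^sup>2 \<le> \<phi> x * \<phi> y"
        using x y w0 J_I[OF e(2)[of v]] by (intro two_lower) (auto simp: w[symmetric] intro!: power_strict_mono)
    qed (use e w0 in auto)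
  qed
  then show "sqrt (x * y) \<in> J" "\<phi> x * \<phi> y = (\<phi> (sqrt (x * y)))\<^sup>2"
    using wJ by (simp_all add: w_def)
qed

text \<open>A relation \<open>(j - b)\<^sup>2 = (i - b) * (k - b)\<close> among the numbers 0 to 9
  yields, by \<open>three_eq\<close> at \<open>a + b * h\<close>, an identity for the normalised
  differences \<open>F\<close>; seven such relations feed \<open>ratio_eq_2\<close>.\<close>

lemma midpoint:
  assumes aJ: "a \<in> J" and h: "0 < h" and last: "a + 9 * h \<in> J"
  shows "\<phi> (a + 2 * h) - \<phi> a = 2 * (\<phi> (a + h) - \<phi> a)"
proof -
  define p where "p = \<phi> (a + h) - \<phi> a"
  define F where "F k = (\<phi> (a + k * h) - \<phi> a) / p" for k
  have mem: "a + k * h \<in> J" if "0 \<le> k" "k \<le> 9" for k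
    using J_between[OF aJ last, of "a + k * h"] that h by simp
  have p: "0 < p" using strict[OF aJ mem[of 1]] h by (simp add: p_def)
  have less: "F j < F k" if "0 \<le> j" "j < k" "k \<le> 9" for j k
    using strict[OF mem[of j] mem[of k]] that h p by (simp add: F_def divide_strict_right_mono)
  have F: "\<phi> (a + k * h) = \<phi> a + F k * p" for k using p by (simp add: F_def)
  have eq: "(F i - F b) * (F k - F b) = (F j - F b)\<^sup>2"
    if "0 \<le> b" "b < i" "b < j" "b < k" "i \<le> 9" "k \<le> 9" "(j - b)\<^sup>2 = (i - b) * (k - b)" for b i j k
  proof -
    have "(\<phi> (a + b * h + (i - b) * h) - \<phi> (a + b * h)) * (\<phi> (a + b * h + (k - b) * h) - \<phi> (a + b * h))
        = (\<phi> (a + b * h + (j - b) * h) - \<phi> (a + b * h))\<^sup>2"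
    proof (rule three_eq)
      show "a + b * h \<in> J" using that by (intro mem) auto
      have pt: "a + b * h + (l - b) * h = a + l * h" for l by (simp add: algebra_simps)
      show "a + b * h + (i - b) * h \<in> J" "a + b * h + (k - b) * h \<in> J"
        unfolding pt using that by (auto intro!: mem)
      show "((j - b) * h)\<^sup>2 = (i - b) * h * ((k - b) * h)"
        unfolding power_mult_distrib that(7) by (simp add: power2_eq_square)
    qed (use that h in auto)
    moreover have "a + b * h + (l - b) * h = a + l * h" for l by (simp add: algebra_simps)
    ultimately have "(F i * p - F b * p) * (F k * p - F b * p) = (F j * p - F b * p)\<^sup>2"
      by (simp add: F)
    then have "((F i - F b) * (F k - F b)) * p\<^sup>2 = (F j - F b)\<^sup>2 * p\<^sup>2"
      by (simp add: power2_eq_square algebra_simps)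
    then show ?thesis using p by simp
  qed
  have F0: "F 0 = 0" and F1: "F 1 = 1" using p by (auto simp: F_def p_def)
  have "F 2 = 2"
  proof (rule ratio_eq_2)
    show "1 < F 2" using less[of 1 2] F1 by simp
    show "0 < F 3" "0 < F 6" using less[of 0 3] less[of 0 6] F0 by simp_all
    show "F 4 = (F 2)\<^sup>2" using eq[of 0 1 2 4] by (simp add: F0 F1)
    show "F 2 * F 8 = (F 4)\<^sup>2" using eq[of 0 2 4 8] by (simp add: F0)
    show "F 9 = (F 3)\<^sup>2" using eq[of 0 1 3 9] by (simp add: F0 F1)
    show "F 4 * F 9 = (F 6)\<^sup>2" using eq[of 0 4 6 9] by (simp add: F0)
    show "(F 2 - 1) * (F 5 - 1) = (F 3 - 1)\<^sup>2" using eq[of 1 2 3 5] by (simp add: F1)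
    show "(F 3 - F 2) * (F 6 - F 2) = (F 4 - F 2)\<^sup>2" using eq[of 2 3 4 6] by simp
    show "(F 5 - F 4) * (F 8 - F 4) = (F 6 - F 4)\<^sup>2" using eq[of 4 5 6 8] by simp
  qed
  then show ?thesis using F[of 2] F[of 1] F1 by simp
qed

text \<open>The difference to the chord vanishes at both ends and inherits a midpoint identity at
  every interior point; the maximum principle for it and for its negative makes it zero.\<close>

lemma chord:
  assumes a: "a \<in> J" and b: "b \<in> J" and ab: "a < b" and x: "a \<le> x" "x \<le> b"
  shows "\<phi> x = \<phi> a + (\<phi> b - \<phi> a) / (b - a) * (x - a)"
proof -
  define m where "m = (\<phi> b - \<phi> a) / (b - a)"
  define g where "g x = \<phi> x - (\<phi> a + m * (x - a))" for x
  have J: "z \<in> J" if "a \<le> z" "z \<le> b" for z using J_between a b that by blast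
  have cont: "continuous_on {a..b} g"
    unfolding g_def using J isCont_J
    by (intro continuous_intros continuous_at_imp_continuous_on) auto
  have ends: "g a = 0" "g b = 0" using ab by (auto simp: g_def m_def)
  have mid: "\<exists>h>0. a \<le> c - h \<and> c + h \<le> b \<and> g (c - h) + g (c + h) = 2 * g c" if c: "a < c" "c < b" for c
  proof -
    \<comment> \<open>Applied at \<open>c - h\<close>, \<open>midpoint\<close> reaches up to
      \<open>c + 8 * h\<close>; a ninth of the distance to the nearer end suffices.\<close>
    define h where "h = min (c - a) (b - c) / 9"
    have h: "0 < h" "9 * h \<le> c - a" "9 * h \<le> b - c" using c by (auto simp: h_def min_def)
    have "\<phi> (c - h + 2 * h) - \<phi> (c - h) = 2 * (\<phi> (c - h + h) - \<phi> (c - h))"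
      using h by (intro midpoint J) auto
    then have "g (c - h) + g (c + h) = 2 * g c"
      unfolding g_def by (simp add: algebra_simps)
    then show ?thesis using h by (intro exI[of _ h]) auto
  qed
  have "g x \<le> 0"
    using locally_midpoint_affine_le_zero[OF cont _ ends mid] ab x by auto
  moreover have "- g x \<le> 0"
  proof (rule locally_midpoint_affine_le_zero[of a b "\<lambda>x. - g x"])
    show "\<exists>h>0. a \<le> c - h \<and> c + h \<le> b \<and> - g (c - h) + - g (c + h) = 2 * - g c" if that: "a < c" "c < b" for c
    proof -
      obtain h where h: "0 < h" "a \<le> c - h" "c + h \<le> b" "g (c - h) + g (c + h) = 2 * g c"
        using mid \<open>a < c\<close> \<open>c < b\<close> by blast
      then show ?thesis by (intro exI[of _ h]) auto
    qed
  qed (use cont ends ab x in \<open>auto intro: continuous_intros\<close>)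
  ultimately show ?thesis by (simp add: g_def m_def)
qed

text \<open>Each \<open>x\<close> lies with \<open>p\<close> and \<open>q\<close> in one interval
  with ends in \<open>J\<close>, so a single chord passes through all three points and has the slope
  determined by \<open>p\<close> and \<open>q\<close>.\<close>

lemma affine:
  obtains \<alpha> \<beta> where "0 < \<alpha>" "\<And>x. x \<in> J \<Longrightarrow> \<phi> x = \<alpha> * x + \<beta>"
proof -
  obtain p q where pq: "p \<in> J" "q \<in> J" "p < q" by (rule J_two)
  define \<alpha> where "\<alpha> = (\<phi> q - \<phi> p) / (q - p)"
  have "0 < \<alpha>" using pq strict[of p q] by (simp add: \<alpha>_def)
  have "\<phi> x = \<phi> p + \<alpha> * (x - p)" if x: "x \<in> J" for x
  proof -
    define a b where "a = min x p" and "b = max x q"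
    have ab: "a \<in> J" "b \<in> J" "a < b" "a \<le> p" "q \<le> b" "a \<le> x" "x \<le> b" "p \<le> b" "a \<le> q"
      using pq x by (auto simp: a_def b_def min_def max_def)
    define m where "m = (\<phi> b - \<phi> a) / (b - a)"
    have c: "\<phi> z = \<phi> a + m * (z - a)" if "a \<le> z" "z \<le> b" for z
      using chord[OF ab(1,2,3) that] by (simp add: m_def)
    have "\<alpha> = m" unfolding \<alpha>_def c[of q, OF ab(9,5)] c[of p, OF ab(4,8)] using pq
      by (simp add: field_simps)
    then show ?thesis using c[of x] c[of p] ab by (simp add: algebra_simps)
  qed
  then have "\<phi> x = \<alpha> * x + (\<phi> p - \<alpha> * p)" if "x \<in> J" for x using that by (simp add: algebra_simps)
  then show ?thesis using that \<open>0 < \<alpha>\<close> by blast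
qed

text \<open>The identity \<open>two_eq\<close> inside \<open>J\<close> forces
  \<open>\<beta> = 0\<close>; with one factor from \<open>J\<close> it carries the formula to
  positive end points. The point zero needs a squeeze.\<close>

lemma linear: "\<exists>\<alpha>>0. \<forall>x\<in>I. \<phi> x = \<alpha> * x"
proof -
  obtain \<alpha> \<beta> where \<alpha>: "0 < \<alpha>" and aff: "\<And>x. x \<in> J \<Longrightarrow> \<phi> x = \<alpha> * x + \<beta>"
    using affine by metis
  have "\<beta> = 0"
  proof -
    obtain p q where pq: "p \<in> J" "q \<in> J" "p < q" by (rule J_two)
    define w where "w = sqrt (p * q)"
    have w: "w \<in> J" "\<phi> p * \<phi> q = (\<phi> w)\<^sup>2" unfolding w_def using two_eq[of p q] J_I J_pos[OF pq(1)] pq by auto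
    have w2: "w * w = p * q" using J_pos[OF pq(1)] J_pos[OF pq(2)] by (simp add: w_def)
    have "(\<alpha> * p + \<beta>) * (\<alpha> * q + \<beta>) = (\<alpha> * w + \<beta>) * (\<alpha> * w + \<beta>)"
      using w(2) aff[OF pq(1)] aff[OF pq(2)] aff[OF w(1)] by (simp add: power2_eq_square)
    then have "\<alpha> * \<beta> * (p + q) - \<alpha> * \<beta> * (2 * w) = \<alpha> * \<alpha> * (w * w - p * q)"
      by (simp add: algebra_simps)
    then have "\<alpha> * \<beta> * (p + q - 2 * w) = 0" using w2 by (simp add: algebra_simps)
    \<comment> \<open>Strict inequality between the arithmetic and geometric means of the distinct
      \<open>p\<close> and \<open>q\<close>.\<close>
    moreover have "p + q - 2 * w \<noteq> 0"
    proof
      assume "p + q - 2 * w = 0"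
      then have "2 * w = p + q" by simp
      have "4 * (p * q) = (2 * w) * (2 * w)" using w2 by simp
      then have "4 * (p * q) = (p + q) * (p + q)" unfolding \<open>2 * w = p + q\<close> .
      then have "(p - q)\<^sup>2 = 0" by (simp add: power2_eq_square algebra_simps)
      then show False using pq by simp
    qed
    ultimately show ?thesis using \<alpha> by simp
  qed
  then have lin: "\<phi> x = \<alpha> * x" if "x \<in> J" for x using aff that by simp
  have "\<phi> x = \<alpha> * x" if x: "x \<in> I" for x
  proof (cases "x = 0")
    case False
    then have x0: "0 < x" using I_nonneg[OF x] by simp
    obtain y where y: "y \<in> J" using J_two by blast
    have "\<phi> x * (\<alpha> * y) = (\<alpha> * sqrt (x * y))\<^sup>2"
      using two_eq[OF x x0 y] lin y by simp
    also have "\<dots> = (\<alpha> * x) * (\<alpha> * y)"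
      using x0 J_pos[OF y] by (simp add: power_mult_distrib) (simp add: power2_eq_square)
    finally show ?thesis using \<alpha> J_pos[OF y] by simp
  next
    case True
    obtain y where y: "y \<in> J" using J_two by blast
    have "(\<phi> 0)\<^sup>2 \<le> 0 + e" if e: "0 < e" for e
    proof -
      \<comment> \<open>The bound \<open>sqrt e / \<alpha>\<close> makes the square of
        \<open>\<alpha> * z\<close> at most \<open>e\<close>; \<open>two_lower\<close> with
        \<open>0\<close> in the role of \<open>w\<close> then bounds the square of
        \<open>\<phi> 0\<close>.\<close>
      define z where "z = min y (sqrt e / \<alpha>)"
      have z: "0 < z" "z \<le> y" "z \<le> sqrt e / \<alpha>" using J_pos[OF y] \<alpha> e by (auto simp: z_def)
      have "z \<in> J"
      proof (cases "z = y")
        case False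
        then show ?thesis using z x True J_I[OF y] by (intro J_between_I[of 0 y]) auto
      qed (use y in simp)
      then have "(\<phi> 0)\<^sup>2 \<le> \<phi> z * \<phi> z"
        using x True z J_I by (intro two_lower) auto
      also have "\<dots> = (\<alpha> * z) * (\<alpha> * z)" using lin[OF \<open>z \<in> J\<close>] by simp
      also have "\<dots> \<le> sqrt e * sqrt e"
        using z \<alpha> e by (intro mult_mono) (auto simp: field_simps)
      finally show ?thesis using e by simp
    qed
    then have "(\<phi> 0)\<^sup>2 \<le> 0" by (rule field_le_epsilon)
    then show ?thesis using True by simp
  qed
  then show ?thesis using \<alpha> by blast
qed
end

section \<open>Matrices of size two and three\<close>

definition mat2 :: "real \<Rightarrow> real \<Rightarrow> real \<Rightarrow> nat \<Rightarrow> nat \<Rightarrow> real" where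
  "mat2 x w y i j = (if i = 0 \<and> j = 0 then x else if i = 1 \<and> j = 1 then y else w)"

text \<open>The sum \<open>i + j\<close> tells the off-diagonal positions apart and makes symmetry
  automatic. Indices out of range still return a parameter, so \<open>mat3_map\<close> is an
  equality of functions.\<close>

definition mat3 :: "real \<Rightarrow> real \<Rightarrow> real \<Rightarrow> real \<Rightarrow> real \<Rightarrow> real \<Rightarrow> nat \<Rightarrow> nat \<Rightarrow> real" where
  "mat3 p q r u v t i j =
    (if i = j then (if i = 0 then p else if i = 1 then q else r)
     else if i + j = 1 then u else if i + j = 2 then v else t)"

lemma qform_mat2: "qform 2 (mat2 x w y) v = x * (v 0)\<^sup>2 + 2 * w * v 0 * v 1 + y * (v 1)\<^sup>2"
  by (simp add: qform_def mat2_def numeral_2_eq_2 power2_eq_square algebra_simps)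

lemma qform_mat3:
  "qform 3 (mat3 p q r u v t) z = p * (z 0)\<^sup>2 + q * (z 1)\<^sup>2 + r * (z 2)\<^sup>2
    + 2 * u * z 0 * z 1 + 2 * v * z 0 * z 2 + 2 * t * z 1 * z 2"
proof -
  have "{..<3} = {0, 1, 2::nat}" by auto
  then show ?thesis by (simp add: qform_def mat3_def power2_eq_square algebra_simps)
qed

lemma mat2_map: "(\<lambda>i j. h (mat2 x w y i j)) = mat2 (h x) (h w) (h y)"
  by (auto simp: mat2_def fun_eq_iff)

lemma mat3_map: "(\<lambda>i j. h (mat3 p q r u v t i j)) = mat3 (h p) (h q) (h r) (h u) (h v) (h t)"
  by (auto simp: mat3_def fun_eq_iff)

lemma ex_less_2: "(\<exists>i<2. P i) \<longleftrightarrow> P 0 \<or> P (1::nat)"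
  by (auto simp: less_2_cases_iff)

lemma ex_less_3: "(\<exists>i<3. P i) \<longleftrightarrow> P 0 \<or> P 1 \<or> P (2::nat)"
proof -
  have "i < 3 \<longleftrightarrow> i = 0 \<or> i = 1 \<or> i = 2" for i :: nat by auto
  then show ?thesis by auto
qed

text \<open>Sufficiency completes the square after multiplication by \<open>x\<close>; necessity
  evaluates at unit vectors and at \<open>(- w, x)\<close>. Both say nothing about \<open>w\<close>
  when \<open>x = 0\<close>, so that semidefinite case is separate.\<close>

lemma form_pos_mat2:
  "form_pos s 2 (mat2 x w y) \<longleftrightarrow>
    (if s then 0 < x \<and> w\<^sup>2 < x * y else 0 \<le> x \<and> 0 \<le> y \<and> w\<^sup>2 \<le> x * y)" (is "_ = ?R")
proof
  assume L: "form_pos s 2 (mat2 x w y)"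
  define q where "q a b = x * a\<^sup>2 + 2 * w * a * b + y * b\<^sup>2" for a b
  have q: "if s then 0 < q a b else 0 \<le> q a b" if "a \<noteq> 0 \<or> b \<noteq> 0" for a b
    using L[unfolded form_pos_def, rule_format, of "\<lambda>i. if i = 0 then a else b"] that
    by (auto simp: ex_less_2 qform_mat2 q_def split: if_splits)
  have q10: "q 1 0 = x" and q01: "q 0 1 = y" by (auto simp: q_def)
  have qx: "q (- w) x = x * (x * y - w\<^sup>2)" by (simp add: q_def power2_eq_square algebra_simps)
  show ?R
  proof (cases s)
    case True
    then have "0 < x" using q[of 1 0] q10 by simp
    moreover have "0 < x * (x * y - w\<^sup>2)" using q[of "- w" x] qx True \<open>0 < x\<close> by simp
    ultimately show ?thesis using True by (simp add: zero_less_mult_iff)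
  next
    case False
    then have xy: "0 \<le> x" "0 \<le> y" using q[of 1 0] q[of 0 1] q10 q01 by simp_all
    have "w\<^sup>2 \<le> x * y"
    proof (cases "x = 0")
      case True
      show ?thesis
      proof (rule ccontr)
        assume "\<not> ?thesis"
        then have w: "w \<noteq> 0" using True by auto
        \<comment> \<open>For \<open>x = 0\<close> and second argument 1 the form is affine in its
          first argument with slope \<open>2 * w\<close>; this argument solves for the value
          \<open>-1\<close>.\<close>
        have "q (- (y + 1) / (2 * w)) 1 = -1" using w True by (simp add: q_def field_simps)
        then show False using q[of "- (y + 1) / (2 * w)" 1] False by simp
      qed
    next
      case x: False
      then have "0 \<le> x * (x * y - w\<^sup>2)" using q[of "- w" x] qx False by simp
      then show ?thesis using x xy by (simp add: zero_le_mult_iff)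
    qed
    then show ?thesis using xy False by simp
  qed
next
  assume R: ?R
  show "form_pos s 2 (mat2 x w y)"
    unfolding form_pos_def ex_less_2 qform_mat2
  proof (intro allI impI)
    fix v :: "nat \<Rightarrow> real" assume v: "v 0 \<noteq> 0 \<or> v 1 \<noteq> 0"
    define a b where "a = v 0" and "b = v 1"
    define Q where "Q = x * a\<^sup>2 + 2 * w * a * b + y * b\<^sup>2"
    have Qx: "x * Q = (x * a + w * b)\<^sup>2 + (x * y - w\<^sup>2) * b\<^sup>2"
      by (simp add: Q_def power2_eq_square algebra_simps)
    have "if s then 0 < Q else 0 \<le> Q"
    proof (cases s)
      case True
      then have x: "0 < x" "0 < x * y - w\<^sup>2" using R by auto
      have "0 < x * Q"
      proof (cases "b = 0")
        case True
        then show ?thesis unfolding Qx using v x by (simp add: a_def b_def)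
      next
        case False
        then have "0 < (x * y - w\<^sup>2) * b\<^sup>2" using x by simp
        then show ?thesis unfolding Qx by (simp add: add_nonneg_pos)
      qed
      then show ?thesis using x True by (simp add: zero_less_mult_iff)
    next
      case False
      then have x: "0 \<le> x" "0 \<le> y" "w\<^sup>2 \<le> x * y" using R by auto
      have "0 \<le> Q"
      proof (cases "x = 0")
        case True
        then have "w = 0" using x(3) by simp
        then show ?thesis using x True by (simp add: Q_def)
      next
        case x0: False
        have "0 \<le> x * Q" unfolding Qx using x by simp
        then show ?thesis using x x0 by (simp add: zero_le_mult_iff)
      qed
      then show ?thesis using False by simp
    qed
    then show "if s then 0 < x * (v 0)\<^sup>2 + 2 * w * v 0 * v 1 + y * (v 1)\<^sup>2
        else 0 \<le> x * (v 0)\<^sup>2 + 2 * w * v 0 * v 1 + y * (v 1)\<^sup>2"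
      by (cases s) (simp_all add: Q_def a_def b_def)
  qed
qed

text \<open>Completing the square in the first variable leaves the form of the Schur
  complement.\<close>

lemma form_pos_mat3_schur:
  "form_pos s 3 (mat3 p q r p p t) \<longleftrightarrow>
    (if s then 0 < p else 0 \<le> p) \<and> form_pos s 2 (mat2 (q - p) (t - p) (r - p))"
proof -
  let ?Q = "qform 2 (mat2 (q - p) (t - p) (r - p))"
  have eq: "qform 3 (mat3 p q r p p t) z = p * (z 0 + z 1 + z 2)\<^sup>2 + ?Q (\<lambda>i. z (Suc i))" for z
    unfolding qform_mat2 qform_mat3 by (simp add: numeral_2_eq_2 power2_eq_square algebra_simps)
  show ?thesis
  proof (intro iffI conjI)
    assume L: "form_pos s 3 (mat3 p q r p p t)"
    show "if s then 0 < p else 0 \<le> p"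
      using L[unfolded form_pos_def ex_less_3, rule_format, of "\<lambda>i. if i = 0 then 1 else 0"]
      by (cases s) (simp_all add: qform_mat3)
    show "form_pos s 2 (mat2 (q - p) (t - p) (r - p))"
      unfolding form_pos_def ex_less_2
    proof (intro allI impI)
      fix x :: "nat \<Rightarrow> real" assume x: "x 0 \<noteq> 0 \<or> x 1 \<noteq> 0"
      \<comment> \<open>The first coordinate is chosen to annihilate the completed square.\<close>
      let ?z = "\<lambda>i. if i = 0 then - (x 0 + x 1) else x (i - 1)"
      have "qform 3 (mat3 p q r p p t) ?z = ?Q x" unfolding eq by simp
      moreover have "?z 0 \<noteq> 0 \<or> ?z 1 \<noteq> 0 \<or> ?z 2 \<noteq> 0" using x by auto
      ultimately show "if s then 0 < ?Q x else 0 \<le> ?Q x"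
        using L[unfolded form_pos_def ex_less_3, rule_format, of ?z] by (cases s) simp_all
    qed
  next
    assume R: "(if s then 0 < p else 0 \<le> p) \<and> form_pos s 2 (mat2 (q - p) (t - p) (r - p))"
    show "form_pos s 3 (mat3 p q r p p t)"
      unfolding form_pos_def ex_less_3
    proof (intro allI impI)
      fix z :: "nat \<Rightarrow> real" assume z: "z 0 \<noteq> 0 \<or> z 1 \<noteq> 0 \<or> z 2 \<noteq> 0"
      have sq: "0 \<le> p * (z 0 + z 1 + z 2)\<^sup>2" using R by (cases s) auto
      show "if s then 0 < qform 3 (mat3 p q r p p t) z else 0 \<le> qform 3 (mat3 p q r p p t) z"
      proof (cases "z 1 = 0 \<and> z 2 = 0")
        case True
        then show ?thesis using z R by (cases s) (simp_all add: qform_mat3)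
      next
        case False
        then have "if s then 0 < ?Q (\<lambda>i. z (Suc i)) else 0 \<le> ?Q (\<lambda>i. z (Suc i))"
          using R[THEN conjunct2, unfolded form_pos_def ex_less_2, rule_format, of "\<lambda>i. z (Suc i)"]
          by (simp add: numeral_2_eq_2)
        then show ?thesis unfolding eq using sq by (cases s) (simp_all add: add_nonneg_pos)
      qed
    qed
  qed
qed

text \<open>The matrix is \<open>c\<close> times the all-ones matrix plus \<open>x - c\<close> times
  the identity.\<close>

lemma form_pos_mat3_constI:
  assumes "0 < c" "if s then c < x else c \<le> x"
  shows "form_pos s 3 (mat3 x x x c c c)"
  unfolding form_pos_def ex_less_3
proof (intro allI impI)
  fix z :: "nat \<Rightarrow> real" assume z: "z 0 \<noteq> 0 \<or> z 1 \<noteq> 0 \<or> z 2 \<noteq> 0"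
  have eq: "qform 3 (mat3 x x x c c c) z = c * (z 0 + z 1 + z 2)\<^sup>2 + (x - c) * ((z 0)\<^sup>2 + (z 1)\<^sup>2 + (z 2)\<^sup>2)"
    by (simp add: qform_mat3 power2_eq_square algebra_simps)
  have "0 < (z 0)\<^sup>2 + (z 1)\<^sup>2 + (z 2)\<^sup>2"
  proof (cases "z 2 = 0")
    case True
    then show ?thesis using z by (simp add: sum_power2_gt_zero_iff)
  qed (simp add: add_nonneg_pos)
  then show "if s then 0 < qform 3 (mat3 x x x c c c) z else 0 \<le> qform 3 (mat3 x x x c c c) z"
    unfolding eq using assms by (cases s) (simp_all add: add_nonneg_pos)
qed

text \<open>At \<open>(1, - 1, - 1)\<close> each off-diagonal pair contributes
  \<open>- 2 * b\<close>, so the form takes the value \<open>3 * (x - 2 * b)\<close>.\<close>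

lemma not_form_pos_mat3_sign:
  assumes "x < 2 * b"
  shows "\<not> form_pos s 3 (mat3 x x x b b (- b))"
proof
  assume "form_pos s 3 (mat3 x x x b b (- b))"
  from this[unfolded form_pos_def ex_less_3, rule_format, of "\<lambda>i. if i = 0 then 1 else - 1"]
  show False using assms by (cases s) (simp_all add: qform_mat3)
qed

section \<open>Passage between small matrices and matrices of size \<open>n\<close>\<close>

locale preserver =
  fixes s :: bool and n :: nat and \<Omega> :: "complex set" and f :: "complex \<Rightarrow> complex"
  assumes n: "3 \<le> n"
    and preserve: "A \<in> symmetric_mats n \<Omega> \<Longrightarrow> pos_mat s A \<longleftrightarrow> pos_mat s (map_mat f A)"
begin

definition \<phi> :: "real \<Rightarrow> real" where "\<phi> x = Re (f (complex_of_real x))"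

text \<open>Values of \<open>f\<close> may be nonreal, so \<open>\<phi>\<close> captures
  \<open>f\<close> only at points with this property, which has to be derived.\<close>

definition real_at :: "real \<Rightarrow> bool" where "real_at x \<longleftrightarrow> f (complex_of_real x) = complex_of_real (\<phi> x)"

text \<open>An admissible surplus for \<open>inflate\<close> when the last diagonal entry is
  \<open>d\<close>: definiteness calls for a larger element of \<open>\<Omega>\<close>,
  semidefiniteness repeats \<open>d\<close>.\<close>

definition slack :: "real \<Rightarrow> real \<Rightarrow> bool" where
  "slack d e \<longleftrightarrow> (if s then 0 < e else e = 0) \<and> complex_of_real (d + e) \<in> \<Omega>"

lemma slackI: "(if s then 0 < e else e = 0) \<Longrightarrow> complex_of_real (d + e) \<in> \<Omega> \<Longrightarrow> slack d e"
  by (simp add: slack_def)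

lemma slack_pos: "slack d e \<Longrightarrow> s \<Longrightarrow> 0 < e"
  unfolding slack_def by simp

lemma inflate_cases:
  assumes "0 < m" "i < n" "j < n"
  obtains k l where "k < m" "l < m" "inflate m e B i j = B k l"
  | "inflate m e B i j = B (m - 1) (m - 1) + e"
proof (cases "i = j \<and> m \<le> i")
  case True
  then have "min i (m - 1) = m - 1" "j = i" "m \<le> i" by auto
  then show ?thesis using that(2) by (simp add: inflate_def)
next
  case False
  have "min i (m - 1) < m" "min j (m - 1) < m" using assms by auto
  then show ?thesis using that(1) False by (simp add: inflate_def)
qed

text \<open>Entrywise maps keep the repeated shape; the surplus becomes an increment of
  \<open>h\<close>, whose sign matters in \<open>reflect\<close>.\<close>

lemma inflate_map:
  assumes "0 < m"
  shows "(\<lambda>i j. h (inflate m e B i j)) =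
    inflate m (h (B (m - 1) (m - 1) + e) - h (B (m - 1) (m - 1))) (\<lambda>i j. h (B i j))"
proof (intro ext)
  fix i j
  have "min i (m - 1) = m - 1" if "m \<le> i" using that by simp
  then show "h (inflate m e B i j) =
      inflate m (h (B (m - 1) (m - 1) + e) - h (B (m - 1) (m - 1))) (\<lambda>i j. h (B i j)) i j"
    by (auto simp: inflate_def)
qed

lemma map_real_mat:
  assumes "\<And>i j. i < n \<Longrightarrow> j < n \<Longrightarrow> real_at (C i j)"
  shows "map_mat f (real_mat n C) = real_mat n (\<lambda>i j. \<phi> (C i j))"
  using assms by (intro eq_matI) (auto simp: real_mat_def real_at_def)

lemma real_mat_symmetric:
  assumes "\<And>i j. C i j = C j i" "\<And>i j. i < n \<Longrightarrow> j < n \<Longrightarrow> complex_of_real (C i j) \<in> \<Omega>"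
  shows "real_mat n C \<in> symmetric_mats n \<Omega>"
proof -
  have "elements_mat (real_mat n C) \<subseteq> \<Omega>"
    using assms(2) by (auto simp: real_mat_def dest!: elements_matD)
  moreover have "transpose_mat (real_mat n C) = real_mat n C"
    using assms(1) by (intro eq_matI) (auto simp: real_mat_def)
  ultimately show ?thesis by (simp add: symmetric_mats_def real_mat_def)
qed

context
  fixes m :: nat and B :: "nat \<Rightarrow> nat \<Rightarrow> real" and e :: real
  assumes m: "0 < m" "m \<le> 3" and sym: "\<And>i j. B i j = B j i"
    and mem: "\<And>i j. i < m \<Longrightarrow> j < m \<Longrightarrow> complex_of_real (B i j) \<in> \<Omega>"
    and e: "slack (B (m - 1) (m - 1)) e"
begin

private lemma inflate_sym: "inflate m e B i j = inflate m e B j i"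
  using sym by (simp add: inflate_def)

private lemma inflate_mem: "i < n \<Longrightarrow> j < n \<Longrightarrow> complex_of_real (inflate m e B i j) \<in> \<Omega>"
  using m mem e by (metis inflate_cases slack_def)

private lemma inflate_symmetric: "real_mat n (inflate m e B) \<in> symmetric_mats n \<Omega>"
  by (rule real_mat_symmetric[OF inflate_sym inflate_mem])

private lemmas inflate_\<phi> = inflate_map[OF m(1), where h = \<phi> and e = e and B = B]

private lemma pos_mat_inflate: "pos_mat s (real_mat n (inflate m e B)) \<longleftrightarrow> form_pos s n (inflate m e B)"
  by (rule pos_mat_real_mat) (rule inflate_sym)

private lemma pos_mat_\<phi>:
  "pos_mat s (real_mat n (\<lambda>i j. \<phi> (inflate m e B i j))) \<longleftrightarrow> form_pos s n (\<lambda>i j. \<phi> (inflate m e B i j))"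
  by (rule pos_mat_real_mat) (rule arg_cong[OF inflate_sym])

text \<open>The image of the enlarged matrix is Hermitian by positivity and symmetric by
  construction, hence real. Shrinking it back accepts any surplus, so this direction is available
  before anything is known about \<open>\<phi>\<close>.\<close>

lemma transfer:
  assumes "form_pos s m B"
  shows "(\<forall>i<m. \<forall>j<m. real_at (B i j)) \<and> form_pos s m (\<lambda>i j. \<phi> (B i j))"
proof -
  let ?A = "real_mat n (inflate m e B)"
  have "form_pos s n (inflate m e B)"
    using m n assms e by (intro form_pos_inflate) (auto simp: slack_def)
  then have "pos_mat s ?A" by (simp only: pos_mat_inflate)
  then have pos: "pos_mat s (map_mat f ?A)"
    using preserve[OF inflate_symmetric] by blast
  then have "hermitian (map_mat f ?A)"
    by (auto simp: pos_mat_def positive_definite_def positive_semidefinite_def split: if_splits)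
  then have herm: "map_mat f ?A $$ (i, j) = cnj (map_mat f ?A $$ (j, i))" if "i < n" "j < n" for i j
    using that hermitian_index[THEN iffD1, of "map_mat f ?A" n] by (metis map_carrier_mat real_mat_carrier)
  have real: "real_at (inflate m e B i j)" if "i < n" "j < n" for i j
  proof -
    have "Im (map_mat f ?A $$ (i, j)) = - Im (map_mat f ?A $$ (j, i))"
      using arg_cong[OF herm[OF that], of Im] by (simp only: cnj.sel(2))
    moreover have "map_mat f ?A $$ (k, l) = f (complex_of_real (inflate m e B k l))" if "k < n" "l < n" for k l
      using that by (simp add: real_mat_def)
    ultimately have "Im (f (complex_of_real (inflate m e B i j))) = 0"
      using that inflate_sym[of i j] by simp
    then show ?thesis by (simp add: real_at_def \<phi>_def complex_eq_iff)
  qed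
  have "pos_mat s (real_mat n (\<lambda>i j. \<phi> (inflate m e B i j)))"
    using pos map_real_mat[OF real] by simp
  then have "form_pos s n (\<lambda>i j. \<phi> (inflate m e B i j))"
    by (simp only: pos_mat_\<phi>)
  then have "form_pos s m (\<lambda>i j. \<phi> (B i j))"
    unfolding inflate_\<phi> using m n by (elim form_pos_inflate_imp[rotated 2]) auto
  moreover have "real_at (B i j)" if "i < m" "j < m" for i j
  proof -
    have "inflate m e B i j = B i j" using that m by (auto simp: inflate_def min_def)
    then show ?thesis using real[of i j] that m n by auto
  qed
  ultimately show ?thesis by blast
qed

text \<open>Here the image is what gets enlarged, so in the definite case \<open>\<phi>\<close> must
  already be known to increase at the last diagonal entry; reality of the entries ties
  \<open>\<phi>\<close> to \<open>f\<close>.\<close>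

lemma reflect:
  assumes real: "\<And>i j. i < m \<Longrightarrow> j < m \<Longrightarrow> real_at (B i j)" "real_at (B (m - 1) (m - 1) + e)"
    and inc: "s \<Longrightarrow> \<phi> (B (m - 1) (m - 1)) < \<phi> (B (m - 1) (m - 1) + e)"
    and pos: "form_pos s m (\<lambda>i j. \<phi> (B i j))"
  shows "form_pos s m B"
proof -
  let ?A = "real_mat n (inflate m e B)"
  have "form_pos s n (\<lambda>i j. \<phi> (inflate m e B i j))"
    unfolding inflate_\<phi> using m n pos inc e by (intro form_pos_inflate) (auto simp: slack_def)
  then have "pos_mat s (real_mat n (\<lambda>i j. \<phi> (inflate m e B i j)))"
    by (simp only: pos_mat_\<phi>)
  moreover have "real_at (inflate m e B i j)" if "i < n" "j < n" for i j
    using m real that by (metis inflate_cases)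
  ultimately have "pos_mat s (map_mat f ?A)" using map_real_mat by simp
  then have "pos_mat s ?A"
    using preserve[OF inflate_symmetric] by blast
  then have "form_pos s n (inflate m e B)" by (simp only: pos_mat_inflate)
  then show ?thesis using m n by (elim form_pos_inflate_imp[rotated 2]) auto
qed

end

lemma mat2_sym: "mat2 x w y i j = mat2 x w y j i"
  by (simp add: mat2_def)

lemma mat3_sym: "mat3 p q r u v t i j = mat3 p q r u v t j i"
  by (simp add: mat3_def add.commute)

lemma transfer_mat2:
  assumes "complex_of_real x \<in> \<Omega>" "complex_of_real w \<in> \<Omega>" "complex_of_real y \<in> \<Omega>" "slack y e"
    and "form_pos s 2 (mat2 x w y)"
  shows "real_at x" "real_at w" "real_at y" "form_pos s 2 (mat2 (\<phi> x) (\<phi> w) (\<phi> y))"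
proof -
  have *: "(\<forall>i<2. \<forall>j<2. real_at (mat2 x w y i j)) \<and> form_pos s 2 (\<lambda>i j. \<phi> (mat2 x w y i j))"
    by (rule transfer[OF _ _ mat2_sym _ _ assms(5)]) (use assms(1-4) in \<open>auto simp: mat2_def\<close>)
  then show "form_pos s 2 (mat2 (\<phi> x) (\<phi> w) (\<phi> y))" by (simp only: mat2_map[of \<phi>])
  have "real_at (mat2 x w y 0 0)" "real_at (mat2 x w y 0 1)" "real_at (mat2 x w y 1 1)" using * by auto
  then show "real_at x" "real_at w" "real_at y" by (simp_all add: mat2_def)
qed

lemma reflect_mat2:
  assumes "complex_of_real x \<in> \<Omega>" "complex_of_real w \<in> \<Omega>" "complex_of_real y \<in> \<Omega>" "slack y e"
    and "real_at x" "real_at w" "real_at y" "real_at (y + e)" "s \<Longrightarrow> \<phi> y < \<phi> (y + e)"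
    and "form_pos s 2 (mat2 (\<phi> x) (\<phi> w) (\<phi> y))"
  shows "form_pos s 2 (mat2 x w y)"
proof (rule reflect[OF _ _ mat2_sym])
  show "form_pos s 2 (\<lambda>i j. \<phi> (mat2 x w y i j))" by (simp only: mat2_map[of \<phi>] assms(10))
qed (use assms(1-9) in \<open>auto simp: mat2_def\<close>)

lemma transfer_mat3:
  assumes "complex_of_real ` {p, q, r, u, v, t} \<subseteq> \<Omega>" "slack r e"
    and "form_pos s 3 (mat3 p q r u v t)"
  shows "form_pos s 3 (mat3 (\<phi> p) (\<phi> q) (\<phi> r) (\<phi> u) (\<phi> v) (\<phi> t))"
proof -
  have "(\<forall>i<3. \<forall>j<3. real_at (mat3 p q r u v t i j)) \<and> form_pos s 3 (\<lambda>i j. \<phi> (mat3 p q r u v t i j))"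
    by (rule transfer[OF _ _ mat3_sym _ _ assms(3)]) (use assms(1,2) in \<open>auto simp: mat3_def\<close>)
  then show ?thesis by (simp only: mat3_map[of \<phi>])
qed

lemma reflect_mat3:
  assumes "complex_of_real ` {p, q, r, u, v, t} \<subseteq> \<Omega>" "slack r e"
    and "\<And>z. z \<in> {p, q, r, u, v, t} \<Longrightarrow> real_at z" "real_at (r + e)" "s \<Longrightarrow> \<phi> r < \<phi> (r + e)"
    and "form_pos s 3 (mat3 (\<phi> p) (\<phi> q) (\<phi> r) (\<phi> u) (\<phi> v) (\<phi> t))"
  shows "form_pos s 3 (mat3 p q r u v t)"
proof (rule reflect[OF _ _ mat3_sym])
  show "form_pos s 3 (\<lambda>i j. \<phi> (mat3 p q r u v t i j))" by (simp only: mat3_map[of \<phi>] assms(6))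
qed (use assms(1-5) in \<open>auto simp: mat3_def\<close>)

end

section \<open>Preservers on an interval\<close>

lemma of_real_mem: "x \<in> nonneg_part \<Omega> \<Longrightarrow> complex_of_real x \<in> \<Omega>"
  by (simp add: nonneg_part_def)

locale interval_preserver = preserver + nonneg_interval "nonneg_part \<Omega>"
begin

lemma J_mem: "x \<in> J \<Longrightarrow> complex_of_real x \<in> \<Omega>"
  using J_I of_real_mem by blast

lemma J_slack:
  assumes "d \<in> J"
  obtains e where "slack d e" "d + e \<in> J"
proof -
  obtain e where e: "0 < e" "\<And>v. d - e \<le> v \<Longrightarrow> v \<le> d + e \<Longrightarrow> v \<in> J"
    using J_nbhd[OF assms] by blast
  show ?thesis
  proof (cases s)
    case True
    have "d + e \<in> J" using e by simp
    then show ?thesis using that[of e] slackI[of e d] e(1) True J_mem[of "d + e"] by simp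
  next
    case False
    then show ?thesis using that[of 0] slackI[of 0 d] assms J_mem by simp
  qed
qed

lemma J_less:
  assumes "x \<in> J"
  obtains y where "y \<in> J" "y < x"
proof -
  obtain e where "0 < e" "\<And>v. x - e \<le> v \<Longrightarrow> v \<le> x + e \<Longrightarrow> v \<in> J"
    using J_nbhd[OF assms] by blast
  then show ?thesis using that[of "x - e"] by simp
qed

text \<open>With \<open>form_pos_mat2D\<close> this gives a strict sufficient and a weak necessary
  determinant test, each valid for both values of \<open>s\<close>.\<close>

lemma form_pos_mat2I:
  assumes "0 < x" "w\<^sup>2 < x * y"
  shows "form_pos s 2 (mat2 x w y)"
proof -
  have "0 < x * y" using assms(2) by (meson le_less_trans zero_le_power2)
  then have "0 < y" using assms(1) by (simp add: zero_less_mult_iff)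
  then show ?thesis using assms by (simp add: form_pos_mat2)
qed

lemma form_pos_mat2D:
  assumes "form_pos s 2 (mat2 x w y)"
  shows "w\<^sup>2 \<le> x * y"
  using assms by (cases s) (simp_all add: form_pos_mat2)

text \<open>A point below some element of \<open>J\<close> fits off the diagonal of a positive
  matrix; any other point is at least every element of \<open>J\<close> and fits on the diagonal.
  The last diagonal entry is interior and so has slack.\<close>

lemma real_at_nonneg:
  assumes x: "x \<in> nonneg_part \<Omega>"
  shows "real_at x"
proof (cases "\<exists>y\<in>J. x < y")
  case True
  then obtain y where y: "y \<in> J" "x < y" by blast
  obtain e where e: "slack y e" using J_slack[OF y(1)] by blast
  have "x * x < y * y" using y(2) I_nonneg[OF x] by (intro mult_strict_mono) auto
  then have "form_pos s 2 (mat2 y x y)"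
    using y J_pos[of y] by (intro form_pos_mat2I) (simp_all add: power2_eq_square)
  then show ?thesis using transfer_mat2(2)[OF J_mem[OF y(1)] of_real_mem[OF x] J_mem[OF y(1)] e] by blast
next
  case False
  obtain p q where pq: "p \<in> J" "q \<in> J" "p < q" by (rule J_two)
  obtain e where e: "slack q e" using J_slack[OF pq(2)] by blast
  have "q \<le> x" using False pq(2) by force
  then have "p * p < x * q" "0 < x" using J_pos[OF pq(1)] pq(3) by (auto intro: mult_strict_mono)
  then have "form_pos s 2 (mat2 x p q)" by (intro form_pos_mat2I) (simp_all add: power2_eq_square)
  then show ?thesis
    using transfer_mat2(1)[OF of_real_mem[OF x] J_mem[OF pq(1)] J_mem[OF pq(2)] e] by blast
qed

lemma real_at_J: "x \<in> J \<Longrightarrow> real_at x"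
  using real_at_nonneg J_I by blast

lemma nonneg_J:
  assumes "x \<in> J"
  shows "0 \<le> \<phi> x"
proof -
  obtain a where a: "a \<in> J" "a < x" using J_less[OF assms] by blast
  obtain e where e: "slack x e" using J_slack[OF assms] by blast
  have "a * a < x * x" using a J_pos[OF a(1)] by (intro mult_strict_mono) auto
  then have "form_pos s 2 (mat2 x a x)"
    using J_pos[OF assms] by (intro form_pos_mat2I) (simp_all add: power2_eq_square)
  then have "form_pos s 2 (mat2 (\<phi> x) (\<phi> a) (\<phi> x))"
    using transfer_mat2(4)[OF J_mem[OF assms] J_mem[OF a(1)] J_mem[OF assms] e] by blast
  then show ?thesis by (cases s) (simp_all add: form_pos_mat2)
qed

text \<open>Strictness comes from opposite directions: in the definite case
  \<open>mat2 b a b\<close> is positive and is transferred; in the semidefinite case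
  \<open>mat2 a b a\<close> is not positive, and by \<open>reflect_mat2\<close> neither is its
  image.\<close>

lemma strict_J:
  assumes a: "a \<in> J" and b: "b \<in> J" and ab: "a < b"
  shows "\<phi> a < \<phi> b"
proof (rule power2_less_imp_less)
  show "0 \<le> \<phi> b" using b by (rule nonneg_J)
  show "(\<phi> a)\<^sup>2 < (\<phi> b)\<^sup>2"
  proof (cases s)
    case True
    obtain e where e: "slack b e" using J_slack[OF b] by blast
    have "a * a < b * b" using ab J_pos[OF a] by (intro mult_strict_mono) auto
    then have "form_pos s 2 (mat2 b a b)"
      using J_pos[OF b] by (intro form_pos_mat2I) (simp_all add: power2_eq_square)
    then have "form_pos s 2 (mat2 (\<phi> b) (\<phi> a) (\<phi> b))"
      using transfer_mat2(4)[OF J_mem[OF b] J_mem[OF a] J_mem[OF b] e] by blast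
    then show ?thesis using True by (simp add: form_pos_mat2 power2_eq_square)
  next
    case False
    have sl: "slack a 0" using False J_mem[OF a] by (intro slackI) simp_all
    have "a * a < b * b" using ab J_pos[OF a] by (intro mult_strict_mono) auto
    then have "\<not> form_pos s 2 (mat2 a b a)" using form_pos_mat2D[of a b a] by (auto simp: power2_eq_square)
    then have "\<not> form_pos s 2 (mat2 (\<phi> a) (\<phi> b) (\<phi> a))"
      using reflect_mat2[OF J_mem[OF a] J_mem[OF b] J_mem[OF a] sl] real_at_J[OF a] real_at_J[OF b] False
      by auto
    then show ?thesis using False nonneg_J[OF a] by (simp add: form_pos_mat2 power2_eq_square not_le)
  qed
qed

lemma pos_J: "x \<in> J \<Longrightarrow> 0 < \<phi> x"
  using J_less nonneg_J strict_J by (metis le_less_trans)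

text \<open>Lower bounds transfer positivity to the image; upper bounds reflect a positive image and
  reach a contradiction. The three-point bounds use a matrix with Schur complement
  \<open>mat2 x w y\<close>.\<close>

sublocale geometric_mean "nonneg_part \<Omega>" \<phi>
proof
  show "\<phi> x < \<phi> y" if "x \<in> J" "y \<in> J" "x < y" for x y using that by (rule strict_J)
  show "0 < \<phi> x" if "x \<in> J" for x using that by (rule pos_J)
next
  fix a x y w
  assume a: "a \<in> J" and J: "a + x \<in> J" "a + y \<in> J" "a + w \<in> J" and p: "0 < x" "0 < y" "0 < w"
  obtain e where e: "slack (a + y) e" "a + y + e \<in> J" using J_slack[OF J(2)] by blast
  have mem: "complex_of_real ` {a, a + x, a + y, a, a, a + w} \<subseteq> \<Omega>"
    using a J J_mem by (auto simp del: of_real_add)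
  have schur: "form_pos s 3 (mat3 a (a + x) (a + y) a a (a + w)) \<longleftrightarrow> form_pos s 2 (mat2 x w y)"
    using J_pos[OF a] by (simp add: form_pos_mat3_schur)
  have schur_\<phi>: "form_pos s 3 (mat3 (\<phi> a) (\<phi> (a + x)) (\<phi> (a + y)) (\<phi> a) (\<phi> a) (\<phi> (a + w))) \<longleftrightarrow>
      form_pos s 2 (mat2 (\<phi> (a + x) - \<phi> a) (\<phi> (a + w) - \<phi> a) (\<phi> (a + y) - \<phi> a))"
    using pos_J[OF a] by (simp add: form_pos_mat3_schur)
  show "(\<phi> (a + w) - \<phi> a)\<^sup>2 \<le> (\<phi> (a + x) - \<phi> a) * (\<phi> (a + y) - \<phi> a)" if "w\<^sup>2 < x * y"
  proof (rule form_pos_mat2D)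
    have "form_pos s 3 (mat3 a (a + x) (a + y) a a (a + w))"
      unfolding schur using p that by (intro form_pos_mat2I)
    then show "form_pos s 2 (mat2 (\<phi> (a + x) - \<phi> a) (\<phi> (a + w) - \<phi> a) (\<phi> (a + y) - \<phi> a))"
      using transfer_mat3[OF mem e(1)] schur_\<phi> by blast
  qed
  show "(\<phi> (a + x) - \<phi> a) * (\<phi> (a + y) - \<phi> a) \<le> (\<phi> (a + w) - \<phi> a)\<^sup>2" if w: "x * y < w\<^sup>2"
  proof (rule ccontr)
    assume "\<not> ?thesis"
    then have "form_pos s 2 (mat2 (\<phi> (a + x) - \<phi> a) (\<phi> (a + w) - \<phi> a) (\<phi> (a + y) - \<phi> a))"
      using strict_J[OF a J(1)] p by (intro form_pos_mat2I) auto
    then have "form_pos s 3 (mat3 a (a + x) (a + y) a a (a + w))"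
    proof (intro reflect_mat3[OF mem e(1) _ real_at_J[OF e(2)]])
      show "real_at z" if "z \<in> {a, a + x, a + y, a, a, a + w}" for z using that a J real_at_J by blast
      show "\<phi> (a + y) < \<phi> (a + y + e)" if s
        using slack_pos[OF e(1) that] by (intro strict_J J(2) e(2)) simp
    qed (simp only: schur_\<phi>)
    then show False using schur form_pos_mat2D w by fastforce
  qed
next
  fix x y w assume x: "x \<in> nonneg_part \<Omega>" and y: "y \<in> J"
  obtain e where e: "slack y e" "y + e \<in> J" using J_slack[OF y] by blast
  show "(\<phi> w)\<^sup>2 \<le> \<phi> x * \<phi> y" if w: "w \<in> nonneg_part \<Omega>" "w\<^sup>2 < x * y"
  proof (rule form_pos_mat2D)
    have "0 < x * y" using w(2) by (meson le_less_trans zero_le_power2)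
    then have "0 < x" using J_pos[OF y] by (simp add: zero_less_mult_iff)
    then show "form_pos s 2 (mat2 (\<phi> x) (\<phi> w) (\<phi> y))"
      using w of_real_mem x J_mem[OF y] e by (intro transfer_mat2[of x w y e] form_pos_mat2I)
  qed
  show "\<phi> x * \<phi> y \<le> (\<phi> w)\<^sup>2" if w: "w \<in> J" "x * y < w\<^sup>2"
  proof (rule ccontr)
    assume less: "\<not> ?thesis"
    \<comment> \<open>Positivity of \<open>\<phi>\<close> is so far known only on \<open>J\<close>,
      and \<open>x\<close> may be an end point; the negated claim itself supplies
      \<open>0 < \<phi> x\<close>.\<close>
    then have "0 < \<phi> x * \<phi> y" by (meson le_less_trans not_le zero_le_power2)
    then have "0 < \<phi> x" using pos_J[OF y] by (simp add: zero_less_mult_iff)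
    then have "form_pos s 2 (mat2 (\<phi> x) (\<phi> w) (\<phi> y))" using less by (intro form_pos_mat2I) auto
    moreover have "\<phi> y < \<phi> (y + e)" if s
      using slack_pos[OF e(1) that] by (intro strict_J y e(2)) simp
    ultimately have "form_pos s 2 (mat2 x w y)"
      using reflect_mat2[OF of_real_mem[OF x] J_mem[OF w(1)] J_mem[OF y] e(1)]
        real_at_nonneg[OF x] real_at_J[OF w(1)] real_at_J[OF y] real_at_J[OF e(2)] by blast
    then show False using form_pos_mat2D w(2) by fastforce
  qed
qed

text \<open>
  The diagonal entries \<open>t \<in> S\<close> make the matrix \<open>[[t, - b], [- b, t]]\<close> positive, those in \<open>T\<close> do not;
  both sets contain or approach \<open>b\<close>.
\<close>

lemma linear_negative:
  assumes \<alpha>: "0 < \<alpha>" and lin: "\<And>x. x \<in> nonneg_part \<Omega> \<Longrightarrow> \<phi> x = \<alpha> * x"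
    and b: "0 < b" "b \<in> nonneg_part \<Omega>" "complex_of_real (- b) \<in> \<Omega>"
    and room: "if s then \<exists>\<epsilon>>0. b + \<epsilon> \<in> nonneg_part \<Omega> else \<exists>\<delta>>0. b - \<delta> \<in> nonneg_part \<Omega>"
  shows "real_at (- b)" "\<phi> (- b) = \<alpha> * (- b)"
proof -
  let ?v = "\<phi> (- b)"
  obtain c where c: "c \<in> nonneg_part \<Omega>" "if s then b < c else c < b"
  proof (cases s)
    case True
    then obtain \<epsilon> where "0 < \<epsilon>" "b + \<epsilon> \<in> nonneg_part \<Omega>" using room by auto
    then show ?thesis using True that[of "b + \<epsilon>"] by simp
  next
    case False
    then obtain \<delta> where "0 < \<delta>" "b - \<delta> \<in> nonneg_part \<Omega>" using room by auto
    then show ?thesis using False that[of "b - \<delta>"] by simp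
  qed
  define S where "S = (if s then {b<..<c} else {b})"
  define T where "T = (if s then {b} else {c<..<b})"
  have I: "t \<in> nonneg_part \<Omega>" if "t \<in> S \<union> T" for t
    using that b(2) c I_interval[of b c t] I_interval[of c b t] by (auto simp: S_def T_def split: if_splits)
  have slack: "\<exists>e. slack t e \<and> t + e \<in> nonneg_part \<Omega>" if "t \<in> S \<union> T" for t
  proof (cases s)
    case True
    then show ?thesis using that c of_real_mem[OF c(1)]
      by (intro exI[of _ "c - t"] conjI slackI) (auto simp: S_def T_def)
  next
    case False
    then show ?thesis using I[OF that] of_real_mem by (intro exI[of _ 0] conjI slackI) simp_all
  qed
  have inc: "s \<Longrightarrow> \<phi> t < \<phi> (t + e)" if "t \<in> S \<union> T" "slack t e" "t + e \<in> nonneg_part \<Omega>" for t e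
    using slack_pos[OF that(2)] \<alpha> lin[OF I[OF that(1)]] lin[OF that(3)] by simp
  have S: "form_pos s 2 (mat2 t (- b) t)" if "t \<in> S" for t
    using that b(1) by (cases s) (simp_all add: form_pos_mat2 S_def power2_eq_square mult_strict_mono)
  have T: "\<not> form_pos s 2 (mat2 t (- b) t)" if "t \<in> T" for t
    using that b(1) I[of t] I_nonneg[of t]
    by (cases s) (simp_all add: form_pos_mat2 T_def power2_eq_square not_le mult_strict_mono)
  have upper: "real_at (- b) \<and> \<bar>?v\<bar> \<le> \<alpha> * t" if t: "t \<in> S" for t
  proof -
    obtain e where e: "slack t e" using slack t by blast
    have t0: "t \<in> nonneg_part \<Omega>" "0 \<le> t" using I t I_nonneg by auto
    have "real_at (- b)" "form_pos s 2 (mat2 (\<phi> t) ?v (\<phi> t))"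
      using transfer_mat2[OF of_real_mem[OF t0(1)] b(3) of_real_mem[OF t0(1)] e S[OF t]] by blast+
    then have "real_at (- b)" "?v\<^sup>2 \<le> (\<alpha> * t)\<^sup>2"
      using form_pos_mat2D lin[OF t0(1)] by (auto simp: power2_eq_square[of "\<alpha> * t"])
    then show ?thesis using \<alpha> t0(2) abs_le_square_iff[of ?v "\<alpha> * t"] by simp
  qed
  have "S \<noteq> {}" using c(2) by (cases s) (simp_all add: S_def)
  then show real: "real_at (- b)" using upper by blast
  have lower: "\<alpha> * t \<le> \<bar>?v\<bar>" if t: "t \<in> T" for t
  proof -
    obtain e where e: "slack t e" "t + e \<in> nonneg_part \<Omega>" using slack t by blast
    have t0: "t \<in> nonneg_part \<Omega>" "0 \<le> t" using I t I_nonneg by auto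
    have "\<not> form_pos s 2 (mat2 (\<phi> t) ?v (\<phi> t))"
      using reflect_mat2[OF of_real_mem[OF t0(1)] b(3) of_real_mem[OF t0(1)] e(1)] T[OF t]
        real real_at_nonneg[OF t0(1)] real_at_nonneg[OF e(2)] inc[OF _ e] t by blast
    then have "\<not> ?v\<^sup>2 < (\<alpha> * t)\<^sup>2"
      using lin[OF t0(1)] \<alpha> t0(2) T_def t b(1) by (cases s) (auto simp: form_pos_mat2 power2_eq_square[of "\<alpha> * t"] power2_eq_square[of "\<alpha> * b"])
    then show ?thesis using \<alpha> t0(2) abs_le_square_iff[of "\<alpha> * t" ?v] by simp
  qed
  \<comment> \<open>The bounds along \<open>S\<close> and \<open>T\<close> meet at \<open>b\<close>:
    one of the sets is \<open>{b}\<close> and the other is an open interval ending at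
    \<open>b\<close>.\<close>
  have "\<bar>?v\<bar> / \<alpha> \<le> b"
  proof (cases s)
    case True
    show ?thesis
    proof (rule dense_ge_bounded)
      show "b < c" using c True by simp
      show "\<bar>?v\<bar> / \<alpha> \<le> t" if "b < t" "t < c" for t
        using upper[of t] that True \<alpha> by (simp add: S_def field_simps)
    qed
  next
    case False
    then show ?thesis using upper[of b] \<alpha> by (simp add: S_def field_simps)
  qed
  moreover have "b \<le> \<bar>?v\<bar> / \<alpha>"
  proof (cases s)
    case True
    then show ?thesis using lower[of b] \<alpha> by (simp add: T_def field_simps)
  next
    case False
    show ?thesis
    proof (rule dense_le_bounded)
      show "c < b" using c False by simp
      show "t \<le> \<bar>?v\<bar> / \<alpha>" if "c < t" "t < b" for t
        using lower[of t] that False \<alpha> by (simp add: T_def field_simps)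
    qed
  qed
  ultimately have "\<bar>?v\<bar> = \<alpha> * b" using \<alpha> by (simp add: field_simps)
  \<comment> \<open>With the wrong sign, all off-diagonal entries of the image of
    \<open>mat3 t t t b b (- b)\<close> would be \<open>\<alpha> * b\<close>, making the image
    positive although the matrix is not.\<close>
  moreover have "?v \<noteq> \<alpha> * b"
  proof
    assume v: "?v = \<alpha> * b"
    obtain t where t: "t \<in> S" "t < 2 * b"
    proof (cases s)
      case True
      obtain t where "b < t" "t < min c (2 * b)" using dense[of b "min c (2 * b)"] c True b(1) by auto
      then show ?thesis using that[of t] True by (simp add: S_def)
    next
      case False
      then show ?thesis using that[of b] b(1) by (simp add: S_def)
    qed
    obtain e where e: "slack t e" "t + e \<in> nonneg_part \<Omega>" using slack t by blast
    have tI: "t \<in> nonneg_part \<Omega>" using I t by blast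
    have "form_pos s 3 (mat3 t t t b b (- b))"
    proof (rule reflect_mat3[OF _ e(1)])
      show "complex_of_real ` {t, t, t, b, b, - b} \<subseteq> \<Omega>" using tI b of_real_mem by auto
      show "real_at z" if "z \<in> {t, t, t, b, b, - b}" for z
        using that real real_at_nonneg[OF tI] real_at_nonneg[OF b(2)] by auto
      show "real_at (t + e)" using e(2) by (rule real_at_nonneg)
      show "s \<Longrightarrow> \<phi> t < \<phi> (t + e)" using inc[OF _ e] t(1) by blast
      show "form_pos s 3 (mat3 (\<phi> t) (\<phi> t) (\<phi> t) (\<phi> b) (\<phi> b) ?v)"
        unfolding v lin[OF tI] lin[OF b(2)] using t \<alpha> b(1)
        by (intro form_pos_mat3_constI) (auto simp: S_def split: if_splits)
    qed
    then show False using not_form_pos_mat3_sign[OF t(2)] by blast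
  qed
  ultimately show "?v = \<alpha> * (- b)" by (auto simp: abs_if split: if_splits)
qed

end

section \<open>Linear maps and the equivalence\<close>

lemma form_pos_scale:
  assumes "0 < \<alpha>"
  shows "form_pos s n (\<lambda>i j. \<alpha> * B i j) \<longleftrightarrow> form_pos s n B"
proof -
  have "qform n (\<lambda>i j. \<alpha> * B i j) x = \<alpha> * qform n B x" for x
    by (simp add: qform_def sum_distrib_left mult.assoc)
  then show ?thesis using assms by (simp add: form_pos_def zero_less_mult_iff zero_le_mult_iff)
qed

text \<open>As \<open>\<Omega>\<close> is real, a symmetric \<open>A\<close> comes from a real form,
  which \<open>f\<close> multiplies by \<open>\<alpha>\<close>.\<close>

lemma linear_preserves:
  assumes \<Omega>: "\<Omega> \<subseteq> \<real>" and \<alpha>: "0 < \<alpha>" and f: "\<forall>x\<in>\<Omega>. f x = complex_of_real \<alpha> * x"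
    and A: "A \<in> symmetric_mats n \<Omega>"
  shows "pos_mat s A \<longleftrightarrow> pos_mat s (map_mat f A)"
proof -
  define a where "a i j = Re (A $$ (i, j))" for i j
  have dim: "dim_row A = n" "dim_col A = n" and tr: "transpose_mat A = A"
    using A by (auto simp: symmetric_mats_def)
  have mem: "A $$ (i, j) \<in> \<Omega>" if "i < n" "j < n" for i j
    using A that elements_matI[of A n n i j] by (auto simp: symmetric_mats_def)
  then have re: "A $$ (i, j) = complex_of_real (a i j)" if "i < n" "j < n" for i j
    using \<Omega> that by (auto simp: a_def intro!: of_real_Re[symmetric])
  have sym: "a i j = a j i" if "i < n" "j < n" for i j
    using that dim index_transpose_mat(1)[of i A j] unfolding a_def tr by simp
  have "A = real_mat n a" using dim re by (intro eq_matI) (auto simp: real_mat_def)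
  moreover have "pos_mat s (real_mat n a) \<longleftrightarrow> form_pos s n a"
    by (rule pos_mat_real_mat) (rule sym)
  ultimately have 1: "pos_mat s A \<longleftrightarrow> form_pos s n a" by simp
  have "map_mat f A = real_mat n (\<lambda>i j. \<alpha> * a i j)"
  proof (rule eq_matI)
    fix i j assume "i < dim_row (real_mat n (\<lambda>i j. \<alpha> * a i j))" "j < dim_col (real_mat n (\<lambda>i j. \<alpha> * a i j))"
    then have ij: "i < n" "j < n" by (simp_all add: real_mat_def)
    then have "map_mat f A $$ (i, j) = complex_of_real \<alpha> * A $$ (i, j)"
      using f mem[OF ij] dim by simp
    then show "map_mat f A $$ (i, j) = real_mat n (\<lambda>i j. \<alpha> * a i j) $$ (i, j)"
      using ij re[OF ij] by (simp add: real_mat_def)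
  qed (simp_all add: dim real_mat_def)
  moreover have "pos_mat s (real_mat n (\<lambda>i j. \<alpha> * a i j)) \<longleftrightarrow> form_pos s n (\<lambda>i j. \<alpha> * a i j)"
    by (rule pos_mat_real_mat) (simp only: sym)
  ultimately have "pos_mat s (map_mat f A) \<longleftrightarrow> form_pos s n a"
    by (simp only: form_pos_scale[OF \<alpha>])
  with 1 show ?thesis by simp
qed

text \<open>Both versions at once, with \<open>room\<close> standing for pd-type or psd-type. The
  condition \<open>nd\<close> excludes cases such as \<open>\<Omega> = {1}\<close>: the all-ones
  matrix is not definite, so \<open>f 1 = 0\<close> satisfies the definite equivalence although no
  positive \<open>\<alpha>\<close> fits.\<close>

lemma preserver_iff_linear:
  assumes n: "3 \<le> n" and \<Omega>: "\<Omega> \<subseteq> \<real>" and mc: "modulus_closed \<Omega>" and int: "is_interval (nonneg_part \<Omega>)"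
    and nd: "\<not> (\<exists>c. nonneg_part \<Omega> = {c})"
    and room: "\<And>z. z \<in> \<Omega> - complex_of_real ` nonneg_part \<Omega> \<Longrightarrow>
      if s then \<exists>\<epsilon>>0. cmod z + \<epsilon> \<in> nonneg_part \<Omega> else \<exists>\<delta>>0. cmod z - \<delta> \<in> nonneg_part \<Omega>"
  shows "(\<forall>A \<in> symmetric_mats n \<Omega>. pos_mat s A \<longleftrightarrow> pos_mat s (map_mat f A)) \<longleftrightarrow>
    (\<exists>\<alpha>::real. \<alpha> > 0 \<and> (\<forall>x \<in> \<Omega>. f x = complex_of_real \<alpha> * x))"
proof (intro iffI)
  assume "\<exists>\<alpha>::real. \<alpha> > 0 \<and> (\<forall>x \<in> \<Omega>. f x = complex_of_real \<alpha> * x)"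
  then show "\<forall>A \<in> symmetric_mats n \<Omega>. pos_mat s A \<longleftrightarrow> pos_mat s (map_mat f A)"
    using linear_preserves[OF \<Omega>] by blast
next
  assume pres: "\<forall>A \<in> symmetric_mats n \<Omega>. pos_mat s A \<longleftrightarrow> pos_mat s (map_mat f A)"
  show "\<exists>\<alpha>::real. \<alpha> > 0 \<and> (\<forall>x \<in> \<Omega>. f x = complex_of_real \<alpha> * x)"
  proof (cases "\<Omega> = {}")
    case True
    then show ?thesis by (auto intro: exI[of _ 1])
  next
    case False
    then obtain z where z: "z \<in> \<Omega>" by blast
    have mod: "cmod z \<in> nonneg_part \<Omega>" if "z \<in> \<Omega>" for z
      using that mc by (simp add: modulus_closed_def nonneg_part_def)
    \<comment> \<open>The modulus of \<open>z\<close> is one point of the interval and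
      \<open>nd\<close> provides a second, so the interval is nondegenerate.\<close>
    have "nonneg_part \<Omega> \<noteq> {cmod z}" using nd by blast
    then obtain w where "w \<in> nonneg_part \<Omega>" "w \<noteq> cmod z" using mod[OF z] by blast
    then have ex: "\<exists>a\<in>nonneg_part \<Omega>. \<exists>b\<in>nonneg_part \<Omega>. a < b"
      using mod[OF z] by (metis linorder_neq_iff)
    interpret interval_preserver s n \<Omega> f
    proof
      show "x \<in> nonneg_part \<Omega>" if "a \<in> nonneg_part \<Omega>" "b \<in> nonneg_part \<Omega>" "a \<le> x" "x \<le> b" for a b x
        using int that unfolding is_interval_1 by blast
    qed (use n pres ex in \<open>auto simp: nonneg_part_def\<close>)
    obtain \<alpha> where \<alpha>: "0 < \<alpha>" and lin: "\<And>x. x \<in> nonneg_part \<Omega> \<Longrightarrow> \<phi> x = \<alpha> * x"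
      using linear by blast
    have "f x = complex_of_real \<alpha> * x" if x: "x \<in> \<Omega>" for x
    proof -
      obtain r where r: "x = complex_of_real r" using x \<Omega> by (meson Reals_cases subsetD)
      have "real_at r \<and> \<phi> r = \<alpha> * r"
      proof (cases "0 \<le> r")
        case True
        then have "r \<in> nonneg_part \<Omega>" using x r by (simp add: nonneg_part_def)
        then show ?thesis using real_at_nonneg lin by blast
      next
        case False
        then have cm: "cmod x = - r" using r by simp
        have "x \<notin> complex_of_real ` nonneg_part \<Omega>" using r False by (auto simp: nonneg_part_def)
        then have "if s then \<exists>\<epsilon>>0. - r + \<epsilon> \<in> nonneg_part \<Omega> else \<exists>\<delta>>0. - r - \<delta> \<in> nonneg_part \<Omega>"
          using room[of x] x cm by auto
        then show ?thesis
          using linear_negative[OF \<alpha> lin, of "- r"] False mod[OF x] cm x r by simp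
      qed
      then show ?thesis by (simp add: real_at_def r)
    qed
    then show ?thesis using \<alpha> by blast
  qed
qed

theorem theorem2:
  fixes n :: nat and \<Omega> :: "complex set" and f :: "complex \<Rightarrow> complex"
  assumes "n \<ge> 3"
    and "\<Omega> \<subseteq> \<real>"
    and "modulus_closed \<Omega>"
    and "is_interval (nonneg_part \<Omega>)"
    and nondegenerate: "\<not> (\<exists>c. nonneg_part \<Omega> = {c})"
  shows "(pd_type \<Omega> \<longrightarrow>
            ((\<forall>A \<in> symmetric_mats n \<Omega>.
                positive_definite A \<longleftrightarrow> positive_definite (map_mat f A))
             \<longleftrightarrow> (\<exists>\<alpha>::real. \<alpha> > 0 \<and> (\<forall>x \<in> \<Omega>. f x = complex_of_real \<alpha> * x))))
       \<and> (psd_type \<Omega> \<longrightarrow>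
            ((\<forall>A \<in> symmetric_mats n \<Omega>.
                positive_semidefinite A \<longleftrightarrow> positive_semidefinite (map_mat f A))
             \<longleftrightarrow> (\<exists>\<alpha>::real. \<alpha> > 0 \<and> (\<forall>x \<in> \<Omega>. f x = complex_of_real \<alpha> * x))))"
proof (intro conjI impI)
  note iff = preserver_iff_linear[OF assms, where f = f, unfolded pos_mat_def]
  show "(\<forall>A \<in> symmetric_mats n \<Omega>. positive_definite A \<longleftrightarrow> positive_definite (map_mat f A))
      \<longleftrightarrow> (\<exists>\<alpha>::real. \<alpha> > 0 \<and> (\<forall>x \<in> \<Omega>. f x = complex_of_real \<alpha> * x))" if "pd_type \<Omega>"
    using iff[of True] that by (simp add: pd_type_def)
  show "(\<forall>A \<in> symmetric_mats n \<Omega>. positive_semidefinite A \<longleftrightarrow> positive_semidefinite (map_mat f A))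
      \<longleftrightarrow> (\<exists>\<alpha>::real. \<alpha> > 0 \<and> (\<forall>x \<in> \<Omega>. f x = complex_of_real \<alpha> * x))" if "psd_type \<Omega>"
    using iff[of False] that by (simp add: psd_type_def)
qed

end
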